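(* Let $T=(V,E)$ be a finite tree with at least one edge, and let $c_*$ and $E_*$ be the minimal limiting curvature and the set of edges attaining it, for the inverse-weight Ricci flow on $T$ from a positive initial metric. Let $C_1,\ldots,C_s$ be the connected components of $G_{E_*}$. Then $$\beta(C_i)=c_*|C_i|\qquad(1\le i\le s),$$ and $$\mathcal S_{E_*}(c_* )\ne\varnothing\quad\Longleftrightarrow\quad \beta(A)>c_*|A|\ \text{ for every }i\text{ and every }\varnothing\ne A\subsetneq C_i .$$
   Context: $T=(V,E)$ is a finite tree with at least one edge; $d_x$ is the combinatorial degree of $x\in V$ and $E(x)$ the set of edges incident to $x$. A positive metric is $w=(w_e)_{e\in E}$ with all $w_e>0$; it induces the path metric $d_w$ on $V$. Put $D_x(w)=\sum_{e\ni x}1/w_e$. For $\alpha\in[0,1)$ let $m_x^\alpha(x)=\alpha$ and $m_x^\alpha(z)=(1-\alpha)\,w_{xz}^{-1}/D_x(w)$ for $z\sim x$. The (inverse-weight) Lin--Lu--Yau curvature of $e=xy$ is $\kappa_e(w)=\lim_{\alpha\uparrow1}\frac{1-W_1(m_x^\alpha,m_y^\alpha)/w_e}{1-\alpha}$, with $W_1$ the $1$-Wasserstein distance for $d_w$. Known formula on trees: $\kappa_{xy}(w)=\frac{2-d_x}{w_{xy}D_x(w)}+\frac{2-d_y}{w_{xy}D_y(w)}$. The normalized flow is $\dot w_e=-w_e(\kappa_e(w)-K(w))$, $K(w)=\sum_f w_f\kappa_f(w)$, with $w_e(0)>0$ and $\sum_e w_e(0)=1$. For every positive initial metric the limits $c_e=\lim_{t\to\infty}\kappa_e(w(t))$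 exist; put $c_*=\min_e c_e$ and $E_*=\{e\in E:c_e=c_*\}$. For $A\subseteq E$ set $\beta(A)=\sum_{x\in V,\,E(x)\subseteq A}(2-d_x)$. For nonempty $C\subseteq E$ let $\Delta_C=\{p\in\mathbb R^C:p_e>0\ \forall e\in C,\ \sum_{e\in C}p_e=1\}$. For $p\in\Delta_C$ and $e\in C$ put $$\kappa_e^C(p)=\sum_{x\in e,\ E(x)\subseteq C}\frac{2-d_x}{p_e\sum_{f\in E(x)}p_f^{-1}},$$ and for $c\in\mathbb R$ let $\mathcal S_C(c)=\{p\in\Delta_C:\kappa_e^C(p)=c\text{ for every }e\in C\}$. $G_C$ is the graph whose vertices are the edges in $C$, two of them being adjacent if they meet at a vertex $x$ with $d_x\ge3$ and $E(x)\subseteq C$. *)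

theory Defs
  imports Complex_Main "HOL-Library.FuncSet"
begin

text \<open>
  A simple graph is given by its vertex set \<open>V\<close> and its set \<open>E\<close> of undirected edges, each edge
  being a two-element subset of \<open>V\<close>. Edge weights are functions on edges; only their values
  on \<open>E\<close> matter.
\<close>

definition walk :: "'a set \<Rightarrow> 'a set set \<Rightarrow> 'a list \<Rightarrow> bool" where
  "walk V E xs \<longleftrightarrow> xs \<noteq> [] \<and> set xs \<subseteq> V \<and> successively (\<lambda>x y. {x, y} \<in> E) xs"

definition cycle :: "'a set \<Rightarrow> 'a set set \<Rightarrow> 'a list \<Rightarrow> bool" where
  "cycle V E xs \<longleftrightarrow> walk V E xs \<and> distinct xs \<and> length xs \<ge> 3 \<and> {last xs, hd xs} \<in> E"

locale finite_tree =
  fixes V :: "'a set" and E :: "'a set set"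
  assumes finite_vertices: "finite V"
    and vertices_nonempty: "V \<noteq> {}"
    and edges: "\<And>e. e \<in> E \<Longrightarrow> e \<subseteq> V \<and> card e = 2"
    and connected: "\<And>x y. x \<in> V \<Longrightarrow> y \<in> V \<Longrightarrow> \<exists>xs. walk V E xs \<and> hd xs = x \<and> last xs = y"
    and acyclic: "\<And>xs. \<not> cycle V E xs"

definition incident :: "'a set set \<Rightarrow> 'a \<Rightarrow> 'a set set" where
  "incident E x = {e \<in> E. x \<in> e}"

definition deg :: "'a set set \<Rightarrow> 'a \<Rightarrow> nat" where
  "deg E x = card (incident E x)"

definition path_metric :: "'a set \<Rightarrow> 'a set set \<Rightarrow> ('a set \<Rightarrow> real) \<Rightarrow> 'a \<Rightarrow> 'a \<Rightarrow> real" where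
  "path_metric V E w x y =
     Inf {\<Sum>(u, v)\<leftarrow>zip xs (tl xs). w {u, v} | xs. walk V E xs \<and> hd xs = x \<and> last xs = y}"

definition inv_weight_sum :: "'a set set \<Rightarrow> ('a set \<Rightarrow> real) \<Rightarrow> 'a \<Rightarrow> real" where
  "inv_weight_sum E w x = (\<Sum>e\<in>incident E x. 1 / w e)"

definition lazy_measure :: "'a set set \<Rightarrow> ('a set \<Rightarrow> real) \<Rightarrow> real \<Rightarrow> 'a \<Rightarrow> 'a \<Rightarrow> real" where
  "lazy_measure E w \<alpha> x z =
     (if z = x then \<alpha>
      else if {x, z} \<in> E then (1 - \<alpha>) * inverse (w {x, z}) / inv_weight_sum E w x
      else 0)"

definition coupling :: "'a set \<Rightarrow> ('a \<Rightarrow> real) \<Rightarrow> ('a \<Rightarrow> real) \<Rightarrow> ('a \<Rightarrow> 'a \<Rightarrow> real) \<Rightarrow> bool" where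
  "coupling V \<mu> \<nu> \<pi> \<longleftrightarrow>
     (\<forall>x\<in>V. \<forall>y\<in>V. \<pi> x y \<ge> 0) \<and>
     (\<forall>x\<in>V. (\<Sum>y\<in>V. \<pi> x y) = \<mu> x) \<and>
     (\<forall>y\<in>V. (\<Sum>x\<in>V. \<pi> x y) = \<nu> y)"

definition wasserstein1 ::
    "'a set \<Rightarrow> ('a \<Rightarrow> 'a \<Rightarrow> real) \<Rightarrow> ('a \<Rightarrow> real) \<Rightarrow> ('a \<Rightarrow> real) \<Rightarrow> real" where
  "wasserstein1 V d \<mu> \<nu> = Inf {\<Sum>x\<in>V. \<Sum>y\<in>V. d x y * \<pi> x y | \<pi>. coupling V \<mu> \<nu> \<pi>}"

definition lly_curvature :: "'a set \<Rightarrow> 'a set set \<Rightarrow> ('a set \<Rightarrow> real) \<Rightarrow> 'a \<Rightarrow> 'a \<Rightarrow> real" where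
  "lly_curvature V E w x y =
     Lim (at_left 1) (\<lambda>\<alpha>.
       (1 - wasserstein1 V (path_metric V E w) (lazy_measure E w \<alpha> x) (lazy_measure E w \<alpha> y)
              / w {x, y}) / (1 - \<alpha>))"

text \<open>
  The curvature is symmetric in the two endpoints, so the choice of an ordering of the
  endpoints of \<open>e\<close> is immaterial.
\<close>

definition edge_curvature :: "'a set \<Rightarrow> 'a set set \<Rightarrow> ('a set \<Rightarrow> real) \<Rightarrow> 'a set \<Rightarrow> real" where
  "edge_curvature V E w e =
     (case SOME (x, y). e = {x, y} of (x, y) \<Rightarrow> lly_curvature V E w x y)"

definition mean_curvature :: "'a set \<Rightarrow> 'a set set \<Rightarrow> ('a set \<Rightarrow> real) \<Rightarrow> real" where
  "mean_curvature V E w = (\<Sum>f\<in>E. w f * edge_curvature V E w f)"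

text \<open>
  A solution of the normalized flow is a curve of positive metrics on \<open>[0, \<infinity>)\<close>; its initial
  metric is \<open>w 0\<close>. The derivative at time 0 is one-sided. Only the initial metric is required
  to have total length 1.
\<close>

definition normalized_flow :: "'a set \<Rightarrow> 'a set set \<Rightarrow> (real \<Rightarrow> 'a set \<Rightarrow> real) \<Rightarrow> bool" where
  "normalized_flow V E w \<longleftrightarrow>
     (\<forall>t\<ge>0. \<forall>e\<in>E. w t e > 0) \<and>
     (\<Sum>e\<in>E. w 0 e) = 1 \<and>
     (\<forall>t\<ge>0. \<forall>e\<in>E. ((\<lambda>s. w s e) has_real_derivative
        - w t e * (edge_curvature V E (w t) e - mean_curvature V E (w t))) (at t within {0..}))"

definition limit_curvature ::
    "'a set \<Rightarrow> 'a set set \<Rightarrow> (real \<Rightarrow> 'a set \<Rightarrow> real) \<Rightarrow> 'a set \<Rightarrow> real" where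
  "limit_curvature V E w e = Lim at_top (\<lambda>t. edge_curvature V E (w t) e)"

definition min_curvature :: "'a set \<Rightarrow> 'a set set \<Rightarrow> (real \<Rightarrow> 'a set \<Rightarrow> real) \<Rightarrow> real" where
  "min_curvature V E w = Min (limit_curvature V E w ` E)"

definition min_edges :: "'a set \<Rightarrow> 'a set set \<Rightarrow> (real \<Rightarrow> 'a set \<Rightarrow> real) \<Rightarrow> 'a set set" where
  "min_edges V E w = {e \<in> E. limit_curvature V E w e = min_curvature V E w}"

definition \<beta> :: "'a set \<Rightarrow> 'a set set \<Rightarrow> 'a set set \<Rightarrow> real" where
  "\<beta> V E A = (\<Sum>x | x \<in> V \<and> incident E x \<subseteq> A. 2 - real (deg E x))"

text \<open>Vectors in \<open>\<real>\<^sup>C\<close> are functions on \<open>C\<close>, extended by \<open>undefined\<close> outside \<open>C\<close>.\<close>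

definition open_simplex :: "'a set set \<Rightarrow> ('a set \<Rightarrow> real) set" where
  "open_simplex C = {p \<in> C \<rightarrow>\<^sub>E {0<..}. (\<Sum>e\<in>C. p e) = 1}"

definition restricted_curvature ::
    "'a set set \<Rightarrow> 'a set set \<Rightarrow> ('a set \<Rightarrow> real) \<Rightarrow> 'a set \<Rightarrow> real" where
  "restricted_curvature E C p e =
     (\<Sum>x | x \<in> e \<and> incident E x \<subseteq> C.
        (2 - real (deg E x)) / (p e * (\<Sum>f\<in>incident E x. inverse (p f))))"

definition const_curvature_metrics ::
    "'a set set \<Rightarrow> 'a set set \<Rightarrow> real \<Rightarrow> ('a set \<Rightarrow> real) set" where
  "const_curvature_metrics E C c =
     {p \<in> open_simplex C. \<forall>e\<in>C. restricted_curvature E C p e = c}"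

text \<open>
  The adjacency relation of the graph \<open>G\<^sub>C\<close>, whose vertex set is \<open>C\<close>, and the vertex sets of
  its connected components.
\<close>

definition meet_rel :: "'a set set \<Rightarrow> 'a set set \<Rightarrow> ('a set \<times> 'a set) set" where
  "meet_rel E C = {(e, f). e \<in> C \<and> f \<in> C \<and> e \<noteq> f \<and>
     (\<exists>x. x \<in> e \<and> x \<in> f \<and> deg E x \<ge> 3 \<and> incident E x \<subseteq> C)}"

definition meet_components :: "'a set set \<Rightarrow> 'a set set \<Rightarrow> 'a set set set" where
  "meet_components E C = C // {(e, f). e \<in> C \<and> f \<in> C \<and> (e, f) \<in> (meet_rel E C)\<^sup>*}"

end

theory Submission
  imports Defs "HOL-Analysis.Function_Topology"
begin

text \<open>
  In logarithmic coordinates \<open>s\<^sub>e = - ln w\<^sub>e\<close> the curvature is the gradient of the concave function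
  \<open>\<Phi>(s) = \<Sum>\<^sub>x (2 - d\<^sub>x) ln (\<Sum>\<^sub>f exp s\<^sub>f)\<close>, the inner sum running over the edges \<open>f\<close> at \<open>x\<close>, and the
  normalized flow is its gradient flow up to common shifts of all coordinates. Gradients lie in the
  polytope of the vectors \<open>\<Sum>\<^sub>x\<^sub>\<in>\<^sub>e (2 - d\<^sub>x) q\<^sub>x(e)\<close>, where each \<open>q\<^sub>x\<close> is a probability
  distribution on the edges at \<open>x\<close>. Let \<open>c\<close> be its point of minimal norm. Along the flow
  \<open>\<Phi>(s) - \<langle>c, s\<rangle>\<close> is bounded above and has derivative at least \<open>(|\<kappa>|\<^sup>2 - |c|\<^sup>2) / 2\<close>, while \<open>|\<kappa>|\<close> does
  not increase; hence \<open>\<kappa>\<close> converges to \<open>c\<close>.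

  The polytope satisfies \<open>p(A) \<le> \<beta>(A)\<close>, and minimality of the norm makes this an equality for \<open>c\<close> on
  the set of edges where \<open>c\<close> is minimal. As \<open>\<beta>\<close> is additive over components, every component is
  tight. A metric of constant curvature on a component is a critical point of the restriction of
  \<open>\<Phi>(s) - c\<^sub>* \<Sum>\<^sub>e s\<^sub>e\<close>, which attains its maximum when the inequalities for proper subsets are
  strict, since it is then coercive modulo shifts.
\<close>

section \<open>The curvature formula on trees\<close>

text \<open>A new vertex either extends the path or already lies on it; in the second case the path
  is cut at its occurrence.\<close>

lemma rtrancl_imp_distinct_path:
  assumes "(a, v) \<in> R\<^sup>*"
  shows "\<exists>xs. xs \<noteq> [] \<and> hd xs = a \<and> last xs = v \<and> distinct xs \<and>
    successively (\<lambda>x y. (x, y) \<in> R) xs \<and> set xs \<subseteq> insert a (Range R)"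
  using assms
proof (induction rule: rtrancl_induct)
  case base
  show ?case by (rule exI[of _ "[a]"]) simp
next
  case (step v u)
  then obtain xs where xs: "xs \<noteq> []" "hd xs = a" "last xs = v" "distinct xs"
    "successively (\<lambda>x y. (x, y) \<in> R) xs" "set xs \<subseteq> insert a (Range R)" by blast
  show ?case
  proof (cases "u \<in> set xs")
    case True
    then obtain ys zs where "xs = ys @ u # zs" by (meson split_list)
    then have "xs = (ys @ [u]) @ zs" by simp
    with xs show ?thesis
      by (intro exI[of _ "ys @ [u]"]) (auto simp: successively_append_iff hd_append)
  next
    case False
    with xs step.hyps show ?thesis
      by (intro exI[of _ "xs @ [u]"]) (auto simp: successively_append_iff)
  qed
qed

lemma path_length_nonneg:
  assumes "successively (\<lambda>x y. {x, y} \<in> E) xs" "\<And>e. e \<in> E \<Longrightarrow> 0 \<le> w e"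
  shows "0 \<le> (\<Sum>(u, v)\<leftarrow>zip xs (tl xs). w {u, v} :: real)"
  using assms(1)
proof (induction xs)
  case (Cons a xs)
  then show ?case by (cases xs) (auto simp: assms(2))
qed simp

text \<open>The differences of \<open>f\<close> telescope along the walk, and each is at most the
  length of its edge.\<close>

lemma potential_diff_le_path_length:
  assumes "successively (\<lambda>x y. {x, y} \<in> E) xs" "xs \<noteq> []"
    and "\<And>u v. {u, v} \<in> E \<Longrightarrow> f u - f v \<le> w {u, v}"
  shows "f (hd xs) - f (last xs) \<le> (\<Sum>(u, v)\<leftarrow>zip xs (tl xs). w {u, v} :: real)"
  using assms(1,2)
proof (induction xs)
  case (Cons a xs)
  then show ?case
  proof (cases xs)
    case (Cons b ys)
    with Cons.IH Cons.prems assms(3)[of a b] show ?thesis by auto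
  qed simp
qed simp

section \<open>Cutting a tree at an edge, and potentials\<close>

text \<open>The component of \<open>a\<close> once the edge \<open>{a, b}\<close> is
  deleted.\<close>

definition side :: "'a set set \<Rightarrow> 'a \<Rightarrow> 'a \<Rightarrow> 'a set" where
  "side E a b = {v. (a, v) \<in> {(u, v). {u, v} \<in> E - {{a, b}}}\<^sup>*}"

lemma side_edge_subset:
  assumes "{u, v} \<in> E" "{u, v} \<noteq> {a, b}" "u \<in> side E a b"
  shows "v \<in> side E a b"
  using assms unfolding side_def by (auto intro: rtrancl_into_rtrancl)

lemma side_edge_iff:
  assumes "{u, v} \<in> E" "{u, v} \<noteq> {a, b}"
  shows "u \<in> side E a b \<longleftrightarrow> v \<in> side E a b"
  using assms side_edge_subset[of u v E a b] side_edge_subset[of v u E a b]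
  by (auto simp: insert_commute)

lemma self_in_side: "a \<in> side E a b"
  by (simp add: side_def)

context finite_tree
begin

lemma finite_edges [simp]: "finite E"
  by (rule finite_subset[of _ "Pow V"]) (use edges finite_vertices in auto)

lemma finite_incident [simp]: "finite (incident E x)"
  by (simp add: incident_def)

lemma edge_ends:
  assumes "{u, v} \<in> E"
  shows "u \<in> V" "v \<in> V" "u \<noteq> v"
  using edges[OF assms] by (auto simp: card_insert_if split: if_splits)

lemma edgeE:
  assumes "e \<in> E"
  obtains u v where "e = {u, v}" "u \<noteq> v"
  using edges[OF assms] by (auto simp: card_2_iff)

lemma edge_in_V: "e \<in> E \<Longrightarrow> x \<in> e \<Longrightarrow> x \<in> V"
  using edges by blast

text \<open>A path from \<open>a\<close> to \<open>b\<close> that avoids the edge would be closed by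
  the edge to a cycle.\<close>

lemma not_in_side:
  assumes "{a, b} \<in> E"
  shows "b \<notin> side E a b"
proof
  let ?R = "{(u, v). {u, v} \<in> E - {{a, b}}}"
  assume "b \<in> side E a b"
  then have "(a, b) \<in> ?R\<^sup>*" by (simp add: side_def)
  from rtrancl_imp_distinct_path[OF this] obtain xs where xs: "xs \<noteq> []" "hd xs = a" "last xs = b"
    "distinct xs" "successively (\<lambda>x y. (x, y) \<in> ?R) xs" "set xs \<subseteq> insert a (Range ?R)" by blast
  have "insert a (Range ?R) \<subseteq> V" using edge_ends assms by auto
  with xs have "walk V E xs"
    unfolding walk_def by (auto elim: successively_mono)
  \<comment> \<open>One vertex would force \<open>a = b\<close>; two vertices would make the path
    traverse the deleted edge.\<close>
  moreover have "length xs \<ge> 3"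
  proof (rule ccontr)
    assume "\<not> length xs \<ge> 3"
    then consider x where "xs = [x]" | x y where "xs = [x, y]"
      using xs(1) by (cases xs; cases "tl xs"; cases "tl (tl xs)") auto
    then show False using xs edge_ends[OF assms] by cases auto
  qed
  ultimately have "cycle V E xs" using xs assms by (simp add: cycle_def insert_commute)
  with acyclic show False by blast
qed

text \<open>On a tree every antisymmetric function on oriented edges is a gradient: sum the
  indicators of the two sides of every edge.\<close>

lemma potential_exists:
  fixes g :: "'a \<Rightarrow> 'a \<Rightarrow> real"
  assumes "\<And>u v. {u, v} \<in> E \<Longrightarrow> g u v = - g v u"
  obtains f where "\<And>u v. {u, v} \<in> E \<Longrightarrow> f u - f v = g u v"
proof
  let ?P = "{(a, b). {a, b} \<in> E}"
  \<comment> \<open>Both orientations of an edge occur in \<open>?P\<close>, so each of them carries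
    half of the jump.\<close>
  let ?i = "\<lambda>u (a, b). (if u \<in> side E a b then g a b / 2 else 0)"
  let ?f = "\<lambda>u. \<Sum>p\<in>?P. ?i u p"
  have fin: "finite ?P"
    by (rule finite_subset[of _ "V \<times> V"]) (use edge_ends finite_vertices in auto)
  fix u v assume uv: "{u, v} \<in> E"
  then have vu: "{v, u} \<in> E" by (simp add: insert_commute)
  have ne: "u \<noteq> v" using edge_ends[OF uv] by simp
  have "?f u - ?f v = (\<Sum>p\<in>?P. ?i u p - ?i v p)"
    by (rule sum_subtractf[symmetric])
  \<comment> \<open>Every other edge leaves \<open>u\<close> and \<open>v\<close> on the same side,
    so its contributions cancel.\<close>
  also have "\<dots> = (\<Sum>p\<in>{(u, v), (v, u)}. ?i u p - ?i v p)"
  proof (rule sum.mono_neutral_right)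
    show "\<forall>p\<in>?P - {(u, v), (v, u)}. ?i u p - ?i v p = 0"
    proof
      fix p assume "p \<in> ?P - {(u, v), (v, u)}"
      then obtain a b where p: "p = (a, b)" "{u, v} \<noteq> {a, b}"
        by (auto simp: doubleton_eq_iff)
      show "?i u p - ?i v p = 0" using side_edge_iff[OF uv p(2)] p(1) by simp
    qed
  qed (use fin uv vu in auto)
  also have "\<dots> = g u v"
    using ne not_in_side[OF uv] not_in_side[OF vu] self_in_side[of u E v] self_in_side[of v E u]
      assms[OF uv] by simp
  finally show "?f u - ?f v = g u v" .
qed

section \<open>Bounds for distances and transport costs\<close>

text \<open>Lower bounds for distances come from potentials and upper bounds from explicit walks, so
  shortest paths need not be identified.\<close>

lemma potential_diff_le_path_metric:
  assumes "x \<in> V" "y \<in> V" "\<And>u v. {u, v} \<in> E \<Longrightarrow> f u - f v \<le> w {u, v}"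
  shows "f x - f y \<le> path_metric V E w x y"
  unfolding path_metric_def
proof (rule cInf_greatest)
  show "{\<Sum>(u, v)\<leftarrow>zip xs (tl xs). w {u, v} |xs. walk V E xs \<and> hd xs = x \<and> last xs = y} \<noteq> {}"
    using connected[OF assms(1,2)] by auto
qed (use potential_diff_le_path_length[of E _ f w] assms(3) in \<open>auto simp: walk_def\<close>)

lemma path_metric_le:
  assumes "walk V E xs" "\<And>e. e \<in> E \<Longrightarrow> 0 \<le> w e"
  shows "path_metric V E w (hd xs) (last xs) \<le> (\<Sum>(u, v)\<leftarrow>zip xs (tl xs). w {u, v})"
  unfolding path_metric_def
proof (rule cInf_lower)
  show "bdd_below {\<Sum>(u, v)\<leftarrow>zip ys (tl ys). w {u, v} |ys.
      walk V E ys \<and> hd ys = hd xs \<and> last ys = last xs}"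
    using path_length_nonneg[of E _ w] assms(2) by (intro bdd_belowI[of _ 0]) (auto simp: walk_def)
qed (use assms(1) in auto)

text \<open>Weak Kantorovich duality: \<open>f u - f v\<close> is integrated against the coupling
  and the marginals separate the two terms.\<close>

lemma wasserstein1_lower:
  assumes "coupling V \<mu> \<nu> \<pi>" "\<And>u v. u \<in> V \<Longrightarrow> v \<in> V \<Longrightarrow> f u - f v \<le> d u v"
  shows "(\<Sum>u\<in>V. f u * \<mu> u) - (\<Sum>v\<in>V. f v * \<nu> v) \<le> (\<Sum>u\<in>V. \<Sum>v\<in>V. d u v * \<pi> u v)"
proof -
  have "(\<Sum>u\<in>V. f u * \<mu> u) = (\<Sum>u\<in>V. \<Sum>v\<in>V. f u * \<pi> u v)"
    using assms(1) by (simp add: coupling_def flip: sum_distrib_left)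
  moreover have "(\<Sum>v\<in>V. f v * \<nu> v) = (\<Sum>u\<in>V. \<Sum>v\<in>V. f v * \<pi> u v)"
    using assms(1) by (subst sum.swap) (simp add: coupling_def flip: sum_distrib_left)
  ultimately have "(\<Sum>u\<in>V. f u * \<mu> u) - (\<Sum>v\<in>V. f v * \<nu> v)
      = (\<Sum>u\<in>V. \<Sum>v\<in>V. (f u - f v) * \<pi> u v)"
    by (simp add: sum_subtractf left_diff_distrib)
  also have "\<dots> \<le> (\<Sum>u\<in>V. \<Sum>v\<in>V. d u v * \<pi> u v)"
    using assms by (intro sum_mono mult_right_mono) (auto simp: coupling_def)
  finally show ?thesis .
qed

section \<open>Lazy measures and the curvature of an edge\<close>

definition neighbors :: "'a \<Rightarrow> 'a set" where
  "neighbors x = {z. {x, z} \<in> E}"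

lemma neighbors_subset: "neighbors x \<subseteq> V - {x}"
proof
  fix z assume "z \<in> neighbors x"
  then have "{x, z} \<in> E" by (simp add: neighbors_def)
  from edge_ends[OF this] show "z \<in> V - {x}" by auto
qed

lemma finite_neighbors [simp]: "finite (neighbors x)"
  using finite_subset[OF neighbors_subset] finite_vertices by blast

lemma sum_neighbors: "(\<Sum>z\<in>neighbors x. h {x, z}) = (\<Sum>e\<in>incident E x. h e)"
proof -
  have inj: "inj_on (\<lambda>z. {x, z}) (neighbors x)"
    by (auto simp: inj_on_def doubleton_eq_iff)
  have "incident E x = (\<lambda>z. {x, z}) ` neighbors x"
  proof (intro equalityI subsetI)
    fix e assume e: "e \<in> incident E x"
    then have "e \<in> E" by (simp add: incident_def)
    then obtain u v where "e = {u, v}" by (rule edgeE)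
    with e show "e \<in> (\<lambda>z. {x, z}) ` neighbors x"
      by (auto simp: incident_def neighbors_def insert_commute)
  qed (auto simp: incident_def neighbors_def)
  then show ?thesis by (simp add: sum.reindex[OF inj])
qed

lemma card_neighbors: "card (neighbors x) = deg E x"
proof -
  have "real (card (neighbors x)) = real (deg E x)"
    using sum_neighbors[of "\<lambda>_. 1 :: real" x] by (simp add: deg_def)
  then show ?thesis by simp
qed

lemma sum_lazy_measure:
  assumes "x \<in> V"
  shows "(\<Sum>z\<in>V. h z * lazy_measure E w \<alpha> x z)
    = \<alpha> * h x + (1 - \<alpha>) / inv_weight_sum E w x * (\<Sum>z\<in>neighbors x. h z / w {x, z})"
proof -
  have "(\<Sum>z\<in>V. h z * lazy_measure E w \<alpha> x z)
      = h x * lazy_measure E w \<alpha> x x + (\<Sum>z\<in>V - {x}. h z * lazy_measure E w \<alpha> x z)"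
    using assms finite_vertices by (simp add: sum.remove)
  also have "(\<Sum>z\<in>V - {x}. h z * lazy_measure E w \<alpha> x z)
      = (\<Sum>z\<in>neighbors x. h z * lazy_measure E w \<alpha> x z)"
    using neighbors_subset finite_vertices
    by (intro sum.mono_neutral_right) (auto simp: lazy_measure_def neighbors_def)
  also have "\<dots> = (\<Sum>z\<in>neighbors x. (1 - \<alpha>) / inv_weight_sum E w x * (h z / w {x, z}))"
    using neighbors_subset
    by (intro sum.cong) (auto simp: lazy_measure_def neighbors_def field_simps)
  finally show ?thesis by (simp add: lazy_measure_def sum_distrib_left mult.commute)
qed

context
  fixes w :: "'a set \<Rightarrow> real"
  assumes pos: "\<And>e. e \<in> E \<Longrightarrow> 0 < w e"
begin

lemma inv_weight_sum_pos:
  assumes "{x, y} \<in> E"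
  shows "0 < inv_weight_sum E w x"
  unfolding inv_weight_sum_def
  by (rule sum_pos) (use assms pos in \<open>auto simp: incident_def\<close>)

lemma sum_lazy_measure_eq_1:
  assumes "{x, y} \<in> E"
  shows "(\<Sum>z\<in>V. lazy_measure E w \<alpha> x z) = 1"
proof -
  have "(\<Sum>z\<in>neighbors x. 1 / w {x, z}) = inv_weight_sum E w x"
    unfolding inv_weight_sum_def by (rule sum_neighbors)
  with sum_lazy_measure[of x "\<lambda>_. 1" w \<alpha>] inv_weight_sum_pos[OF assms] edge_ends[OF assms]
  show ?thesis by simp
qed

lemma lazy_measure_nonneg:
  assumes "{x, y} \<in> E" "0 \<le> \<alpha>" "\<alpha> \<le> 1"
  shows "0 \<le> lazy_measure E w \<alpha> x z"
  using assms inv_weight_sum_pos[OF assms(1)] pos by (auto simp: lazy_measure_def less_imp_le)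

text \<open>A coupling and a 1-Lipschitz potential of equal value certify each other as optimal. The
  bound \<alpha> \<ge> 1/2 ensures that the coupling is nonnegative.\<close>

lemma wasserstein1_edge:
  assumes xy: "{x, y} \<in> E" and \<alpha>: "1/2 \<le> \<alpha>" "\<alpha> < 1"
  shows "wasserstein1 V (path_metric V E w) (lazy_measure E w \<alpha> x) (lazy_measure E w \<alpha> y)
    = w {x, y} + (1 - \<alpha>) * ((real (deg E x) - 2) / inv_weight_sum E w x
                            + (real (deg E y) - 2) / inv_weight_sum E w y)"
proof -
  have yx: "{y, x} \<in> E" using xy by (simp add: insert_commute)
  note ends = edge_ends[OF xy]
  let ?d = "path_metric V E w"
  let ?mx = "lazy_measure E w \<alpha> x" and ?my = "lazy_measure E w \<alpha> y"
  \<comment> \<open>The pairs along which the potential falls at full slope: from the other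
    neighbors of \<open>x\<close> to \<open>x\<close>, then to \<open>y\<close>, then to the other
    neighbors of \<open>y\<close>. It is constant across edges away from \<open>x\<close> and
    \<open>y\<close>.\<close>
  define B where "B u v \<longleftrightarrow> v = x \<and> u \<noteq> y \<or> u = x \<and> v = y \<or> u = y \<and> v \<noteq> x" for u v
  define g where "g u v = (if B u v then w {u, v} else if B v u then - w {u, v} else 0)" for u v
  have asym: "\<not> (B u v \<and> B v u)" if "{u, v} \<in> E" for u v
    using edge_ends[OF that] ends by (auto simp: B_def)
  have "g u v = - g v u" if "{u, v} \<in> E" for u v
    using asym[OF that] by (auto simp: g_def insert_commute)
  then obtain f where f: "\<And>u v. {u, v} \<in> E \<Longrightarrow> f u - f v = g u v"
    using potential_exists by blast
  have lip: "f u - f v \<le> w {u, v}" if "{u, v} \<in> E" for u v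
    using f[OF that] pos[OF that] by (auto simp: g_def)
  have fd: "f u - f v \<le> ?d u v" if "u \<in> V" "v \<in> V" for u v
    by (rule potential_diff_le_path_metric[OF that]) (rule lip)
  have nonneg: "0 \<le> w e" if "e \<in> E" for e using pos[OF that] by simp
  have d0: "?d u u \<le> 0" if "u \<in> V" for u
    using path_metric_le[OF _ nonneg, of "[u]"] that by (simp add: walk_def)
  have d1: "?d u v \<le> w {u, v}" if "{u, v} \<in> E" for u v
    using path_metric_le[OF _ nonneg, of "[u, v]"] that edge_ends[OF that] by (simp add: walk_def)
  have d2: "?d u z \<le> w {u, v} + w {v, z}" if "{u, v} \<in> E" "{v, z} \<in> E" for u v z
    using path_metric_le[OF _ nonneg, of "[u, v, z]"] that edge_ends[OF that(1)] edge_ends[OF that(2)]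
    by (simp add: walk_def)
  have fxy: "f x - f y = w {x, y}" using f[OF xy] by (simp add: g_def B_def)
  have fx: "f z - f x = w {x, z}" if "z \<in> neighbors x" "z \<noteq> y" for z
    using f[of z x] that by (simp add: g_def B_def neighbors_def insert_commute)
  have fy: "f y - f z = w {y, z}" if "z \<in> neighbors y" "z \<noteq> x" for z
    using f[of y z] that by (simp add: g_def B_def neighbors_def insert_commute)
  have ynx: "y \<in> neighbors x" and xny: "x \<in> neighbors y"
    using xy yx by (simp_all add: neighbors_def)
  \<comment> \<open>Complementary slackness: distance and potential difference agree wherever the
    measure charges \<open>v\<close>, and the factor \<open>?my v\<close> kills all other
    cases.\<close>
  have dx: "?d x v * ?my v = (f x - f v) * ?my v" if "v \<in> V" for v
  proof -
    consider "v = y" | "v = x" | "v \<in> neighbors y" "v \<noteq> x" | "v \<noteq> y" "v \<notin> neighbors y" by blast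
    then show ?thesis
    proof cases
      case 1
      with fd[of x y] d1[OF xy] fxy ends show ?thesis by simp
    next
      case 2
      with fd[of x x] d0[of x] ends show ?thesis by simp
    next
      case 3
      then have "{y, v} \<in> E" by (simp add: neighbors_def)
      from d2[OF xy this] fd[of x v] ends that fxy fy[OF 3] have "?d x v = f x - f v" by simp
      then show ?thesis by simp
    qed (simp add: lazy_measure_def neighbors_def)
  qed
  have dy: "?d u y * ?mx u = (f u - f y) * ?mx u" if "u \<in> V" for u
  proof -
    consider "u = x" | "u = y" | "u \<in> neighbors x" "u \<noteq> y" | "u \<noteq> x" "u \<notin> neighbors x" by blast
    then show ?thesis
    proof cases
      case 1
      with fd[of x y] d1[OF xy] fxy ends show ?thesis by simp
    next
      case 2
      with fd[of y y] d0[of y] ends show ?thesis by simp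
    next
      case 3
      then have "{u, x} \<in> E" by (simp add: neighbors_def insert_commute)
      from d2[OF this xy] fd[of u y] ends that fxy fx[OF 3] have "?d u y = f u - f y"
        by (simp add: insert_commute)
      then show ?thesis by simp
    qed (simp add: lazy_measure_def neighbors_def)
  qed
  define L where "L = (\<Sum>u\<in>V. f u * ?mx u) - (\<Sum>v\<in>V. f v * ?my v)"
  \<comment> \<open>Mass starting away from \<open>x\<close> all goes to \<open>y\<close>, and mass
    ending away from \<open>y\<close> all comes from \<open>x\<close>. The pair
    \<open>(x, y)\<close> is left with 2\<alpha> - 1.\<close>
  define \<pi> where "\<pi> u v = (if u = x then ?my v else 0) + (if v = y then ?mx u else 0)
    - (if u = x \<and> v = y then 1 else 0)" for u v
  have \<alpha>': "0 \<le> \<alpha>" "\<alpha> \<le> 1" using \<alpha> by auto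
  note mpos = lazy_measure_nonneg[OF xy \<alpha>'] lazy_measure_nonneg[OF yx \<alpha>']
  note msum = sum_lazy_measure_eq_1[OF xy, of \<alpha>] sum_lazy_measure_eq_1[OF yx, of \<alpha>]
  have "\<pi> u v \<ge> 0" for u v
    using mpos[of u] mpos[of v] \<alpha> by (auto simp: \<pi>_def lazy_measure_def)
  moreover have "(\<Sum>v\<in>V. \<pi> u v) = ?mx u" if "u \<in> V" for u
    using msum ends finite_vertices
    by (cases "u = x") (simp_all add: \<pi>_def sum.distrib sum_subtractf)
  moreover have "(\<Sum>u\<in>V. \<pi> u v) = ?my v" if "v \<in> V" for v
    using msum ends finite_vertices
    by (cases "v = y") (simp_all add: \<pi>_def sum.distrib sum_subtractf)
  ultimately have coup: "coupling V ?mx ?my \<pi>" by (simp add: coupling_def)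
  have "(\<Sum>u\<in>V. \<Sum>v\<in>V. ?d u v * \<pi> u v) =
      (\<Sum>u\<in>V. \<Sum>v\<in>V. if u = x then ?d u v * ?my v else 0)
      + (\<Sum>u\<in>V. \<Sum>v\<in>V. if v = y then ?d u v * ?mx u else 0)
      - (\<Sum>u\<in>V. \<Sum>v\<in>V. if v = y then if u = x then ?d u v else 0 else 0)"
    unfolding sum.distrib[symmetric] sum_subtractf[symmetric]
    by (intro sum.cong) (auto simp: \<pi>_def algebra_simps)
  also have "(\<Sum>u\<in>V. \<Sum>v\<in>V. if u = x then ?d u v * ?my v else 0) = (\<Sum>v\<in>V. ?d x v * ?my v)"
    by (subst sum.swap) (simp add: finite_vertices ends)
  also have "(\<Sum>u\<in>V. \<Sum>v\<in>V. if v = y then ?d u v * ?mx u else 0) = (\<Sum>u\<in>V. ?d u y * ?mx u)"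
    by (simp add: finite_vertices ends)
  also have "(\<Sum>u\<in>V. \<Sum>v\<in>V. if v = y then if u = x then ?d u v else 0 else 0) = ?d x y"
    by (simp add: finite_vertices ends)
  also have "(\<Sum>v\<in>V. ?d x v * ?my v) = f x - (\<Sum>v\<in>V. f v * ?my v)"
    using msum by (simp add: dx left_diff_distrib sum_subtractf flip: sum_distrib_left)
  also have "(\<Sum>u\<in>V. ?d u y * ?mx u) = (\<Sum>u\<in>V. f u * ?mx u) - f y"
    using msum by (simp add: dy left_diff_distrib sum_subtractf flip: sum_distrib_left)
  also have "?d x y = f x - f y" using fd[of x y] d1[OF xy] fxy ends by simp
  finally have cost: "(\<Sum>u\<in>V. \<Sum>v\<in>V. ?d u v * \<pi> u v) = L" by (simp add: L_def)
  have "wasserstein1 V ?d ?mx ?my = L"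
    unfolding wasserstein1_def
  proof (rule cInf_eq_minimum)
    show "L \<in> {\<Sum>u\<in>V. \<Sum>v\<in>V. ?d u v * \<pi> u v |\<pi>. coupling V ?mx ?my \<pi>}"
      using coup cost by force
    show "L \<le> c" if "c \<in> {\<Sum>u\<in>V. \<Sum>v\<in>V. ?d u v * \<pi> u v |\<pi>. coupling V ?mx ?my \<pi>}" for c
      using that wasserstein1_lower[of ?mx ?my _ f ?d] fd by (auto simp: L_def)
  qed
  \<comment> \<open>Centering the potential at \<open>x\<close> in the first sum and at
    \<open>y\<close> in the second removes the lazy mass, so only neighbors contribute.\<close>
  also have "L = (\<Sum>u\<in>V. (f u - f x) * ?mx u) - (\<Sum>v\<in>V. (f v - f y) * ?my v) + (f x - f y)"
    using msum by (simp add: L_def left_diff_distrib sum_subtractf flip: sum_distrib_left)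
  also have "(\<Sum>u\<in>V. (f u - f x) * ?mx u)
      = (1 - \<alpha>) / inv_weight_sum E w x * (\<Sum>z\<in>neighbors x. (f z - f x) / w {x, z})"
    using sum_lazy_measure[OF ends(1), of "\<lambda>u. f u - f x"] by simp
  \<comment> \<open>The neighbor \<open>y\<close> lies below \<open>x\<close> and contributes -1;
    every other neighbor lies above and contributes 1.\<close>
  also have "(\<Sum>z\<in>neighbors x. (f z - f x) / w {x, z}) = (\<Sum>z\<in>neighbors x. 1 - (if z = y then 2 else 0))"
    using fx fxy pos by (intro sum.cong) (force simp: neighbors_def field_simps)+
  also have "\<dots> = real (deg E x) - 2"
    using ynx by (simp add: sum_subtractf card_neighbors)
  also have "(\<Sum>v\<in>V. (f v - f y) * ?my v)
      = (1 - \<alpha>) / inv_weight_sum E w y * (\<Sum>z\<in>neighbors y. (f z - f y) / w {y, z})"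
    using sum_lazy_measure[OF ends(2), of "\<lambda>u. f u - f y"] by simp
  also have "(\<Sum>z\<in>neighbors y. (f z - f y) / w {y, z}) = (\<Sum>z\<in>neighbors y. (if z = x then 2 else 0) - 1)"
  proof (intro sum.cong refl)
    fix z assume z: "z \<in> neighbors y"
    then have "0 < w {y, z}" using pos by (simp add: neighbors_def)
    with z show "(f z - f y) / w {y, z} = (if z = x then 2 else 0) - 1"
      using fy[of z] fxy by (auto simp: field_simps insert_commute)
  qed
  also have "\<dots> = 2 - real (deg E y)"
    using xny by (simp add: sum_subtractf card_neighbors)
  finally show ?thesis using fxy by (simp add: algebra_simps add_divide_distrib diff_divide_distrib)
qed

text \<open>The quotient does not depend on \<alpha> once \<alpha> > 1/2, so the limit is its
  constant value.\<close>

lemma lly_curvature_eq: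
  assumes xy: "{x, y} \<in> E"
  shows "lly_curvature V E w x y = (2 - real (deg E x)) / (w {x, y} * inv_weight_sum E w x)
    + (2 - real (deg E y)) / (w {x, y} * inv_weight_sum E w y)" (is "_ = ?k")
proof -
  have yx: "{y, x} \<in> E" using xy by (simp add: insert_commute)
  have p: "0 < w {x, y}" "0 < inv_weight_sum E w x" "0 < inv_weight_sum E w y"
    using pos[OF xy] inv_weight_sum_pos[OF xy] inv_weight_sum_pos[OF yx] by auto
  have ev: "\<forall>\<^sub>F \<alpha> in at_left 1. ?k = (1 - wasserstein1 V (path_metric V E w) (lazy_measure E w \<alpha> x)
      (lazy_measure E w \<alpha> y) / w {x, y}) / (1 - \<alpha>)"
  proof (rule eventually_at_leftI[of "1/2"])
    fix \<alpha> :: real assume \<alpha>: "\<alpha> \<in> {1/2<..<1}"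
    let ?c = "(real (deg E x) - 2) / inv_weight_sum E w x + (real (deg E y) - 2) / inv_weight_sum E w y"
    have "(1 - (w {x, y} + (1 - \<alpha>) * c) / w {x, y}) / (1 - \<alpha>) = - c / w {x, y}" for c
      using p \<alpha> by (simp add: add_divide_distrib)
    then have "(1 - (w {x, y} + (1 - \<alpha>) * ?c) / w {x, y}) / (1 - \<alpha>) = - ?c / w {x, y}" .
    also have "\<dots> = ?k" using p by (simp add: add_divide_distrib diff_divide_distrib mult.commute)
    finally show "?k = (1 - wasserstein1 V (path_metric V E w) (lazy_measure E w \<alpha> x)
        (lazy_measure E w \<alpha> y) / w {x, y}) / (1 - \<alpha>)"
      using wasserstein1_edge[OF xy, of \<alpha>] \<alpha> by simp
  qed simp
  have "((\<lambda>\<alpha>. (1 - wasserstein1 V (path_metric V E w) (lazy_measure E w \<alpha> x)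
      (lazy_measure E w \<alpha> y) / w {x, y}) / (1 - \<alpha>)) \<longlongrightarrow> ?k) (at_left 1)"
    using tendsto_cong[OF ev] tendsto_const by blast
  then show ?thesis
    unfolding lly_curvature_def by (rule tendsto_Lim[rotated]) simp
qed

text \<open>The formula is symmetric in the endpoints, so the ordering picked by \<open>SOME\<close>
  is harmless, and for \<open>C = E\<close> the condition on stars is always true.\<close>

lemma edge_curvature_eq:
  assumes "e \<in> E"
  shows "edge_curvature V E w e = restricted_curvature E E w e"
proof -
  obtain u v where uv: "e = {u, v}" "u \<noteq> v" using edgeE[OF assms] .
  define xy where "xy = (SOME (x, y). e = {x, y})"
  have "case xy of (x, y) \<Rightarrow> e = {x, y}"
    unfolding xy_def by (rule someI[where P = "\<lambda>(x, y). e = {x, y}" and x = "(u, v)"]) (simp add: uv)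
  then obtain x y where xy: "xy = (x, y)" "e = {x, y}" by (cases xy) auto
  with assms have E: "{x, y} \<in> E" by simp
  have "edge_curvature V E w e = lly_curvature V E w x y"
    using xy(1) by (simp add: edge_curvature_def flip: xy_def)
  moreover have "{z. z \<in> e \<and> incident E z \<subseteq> E} = {x, y}" using xy by (auto simp: incident_def)
  ultimately show ?thesis
    using lly_curvature_eq[OF E] edge_ends[OF E]
    by (simp add: restricted_curvature_def xy(2) inv_weight_sum_def inverse_eq_divide)
qed

end

end

section \<open>Limit curvature as a point of minimal norm\<close>

text \<open>The probability that the random walk without laziness leaves \<open>x\<close> through
  \<open>e\<close>; in the coordinates \<open>- ln (p e)\<close> it is the softmax.\<close>

definition share :: "'a set set \<Rightarrow> ('a set \<Rightarrow> real) \<Rightarrow> 'a \<Rightarrow> 'a set \<Rightarrow> real" where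
  "share E p x e = inverse (p e) / (\<Sum>f\<in>incident E x. inverse (p f))"

lemma restricted_curvature_eq_share:
  "restricted_curvature E C p e =
    (\<Sum>x | x \<in> e \<and> incident E x \<subseteq> C. (2 - real (deg E x)) * share E p x e)"
  by (simp add: restricted_curvature_def share_def divide_inverse mult_ac)

text \<open>With \<open>s e = - ln (p e)\<close> this is \<Phi>(s) - <c, s>, where \<Phi> only
  counts vertices whose star lies in \<open>C\<close>.\<close>

definition energy :: "'a set \<Rightarrow> 'a set set \<Rightarrow> 'a set set \<Rightarrow> ('a set \<Rightarrow> real) \<Rightarrow> ('a set \<Rightarrow> real) \<Rightarrow> real" where
  "energy V E C c p =
     (\<Sum>x | x \<in> V \<and> incident E x \<subseteq> C.
        (2 - real (deg E x)) * ln (\<Sum>f\<in>incident E x. inverse (p f))) + (\<Sum>e\<in>C. c e * ln (p e))"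

text \<open>Values off the incident pairs are fixed to 0, which makes the set compact in the product
  topology on total functions.\<close>

definition edge_distributions :: "'a set \<Rightarrow> 'a set set \<Rightarrow> ('a \<times> 'a set \<Rightarrow> real) set" where
  "edge_distributions V E = {q. (\<forall>z. q z \<in> (if z \<in> Sigma V (incident E) then {0..1} else {0})) \<and>
     (\<forall>x\<in>V. (\<Sum>e\<in>incident E x. q (x, e)) = 1)}"

text \<open>The point of the polytope that belongs to \<open>q\<close>.\<close>

definition excess :: "'a set set \<Rightarrow> ('a \<times> 'a set \<Rightarrow> real) \<Rightarrow> 'a set \<Rightarrow> real" where
  "excess E q e = (\<Sum>x\<in>e. (2 - real (deg E x)) * q (x, e))"

text \<open>Tychonoff's theorem, stated for the topology of the function type.\<close>

lemma compact_Pi_UNIV: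
  fixes S :: "'i \<Rightarrow> 'b::topological_space set"
  assumes "\<And>i. compact (S i)"
  shows "compact {f. \<forall>i. f i \<in> S i}"
proof -
  have "compactin (product_topology (\<lambda>i. euclidean) UNIV) (PiE UNIV S)"
    using assms by (simp add: compactin_PiE)
  moreover have "PiE UNIV S = {f. \<forall>i. f i \<in> S i}" by auto
  ultimately show ?thesis by (simp add: euclidean_product_topology)
qed

lemma nonneg_if_perturbation_nonneg:
  fixes X Y :: real
  assumes "\<And>\<tau>. 0 < \<tau> \<Longrightarrow> \<tau> \<le> 1 \<Longrightarrow> 0 \<le> 2 * \<tau> * X + \<tau>\<^sup>2 * Y"
  shows "0 \<le> X"
proof (rule ccontr)
  assume "\<not> 0 \<le> X"
  \<comment> \<open>With this choice \<tau>Y \<le> -X, hence 2X + \<tau>Y \<le> X < 0.\<close>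
  define \<tau> where "\<tau> = min 1 (- X / (\<bar>Y\<bar> + 1))"
  have \<tau>: "0 < \<tau>" "\<tau> \<le> 1" using \<open>\<not> 0 \<le> X\<close> by (auto simp: \<tau>_def divide_neg_pos)
  have "\<tau> * (\<bar>Y\<bar> + 1) \<le> - X"
    using mult_right_mono[of \<tau> "- X / (\<bar>Y\<bar> + 1)" "\<bar>Y\<bar> + 1"] by (simp add: \<tau>_def)
  moreover have "\<tau> * Y \<le> \<tau> * (\<bar>Y\<bar> + 1)" using \<tau> by (intro mult_left_mono) auto
  ultimately have "2 * X + \<tau> * Y < 0" using \<open>\<not> 0 \<le> X\<close> by linarith
  then have "\<tau> * (2 * X + \<tau> * Y) < 0" using \<tau> by (simp add: mult_pos_neg)
  with assms[OF \<tau>] show False by (simp add: algebra_simps power2_eq_square)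
qed

text \<open>The sum is the covariance of \<open>b + k\<close> and \<open>b\<close> under the weights
  \<open>r\<close>, that is, the variance of \<open>b\<close>.\<close>

lemma weighted_covariance_nonneg:
  fixes r b :: "'i \<Rightarrow> real"
  assumes "finite I" "\<And>i. i \<in> I \<Longrightarrow> 0 \<le> r i" "sum r I = 1"
  shows "0 \<le> (\<Sum>i\<in>I. (b i + k) * (r i * (b i - (\<Sum>j\<in>I. r j * b j))))"
proof -
  define m where "m = (\<Sum>j\<in>I. r j * b j)"
  have "(\<Sum>i\<in>I. (b i + k) * (r i * (b i - m)))
      = (\<Sum>i\<in>I. r i * (b i - m)\<^sup>2 + (m + k) * (r i * b i) - (m + k) * m * r i)"
    by (intro sum.cong) (simp_all add: algebra_simps power2_eq_square)
  also have "\<dots> = (\<Sum>i\<in>I. r i * (b i - m)\<^sup>2)"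
    using assms(3) by (simp add: sum.distrib sum_subtractf m_def flip: sum_distrib_left)
  also have "\<dots> \<ge> 0" using assms by (intro sum_nonneg) simp
  finally show ?thesis by (simp add: m_def)
qed

context finite_tree
begin

text \<open>Double counting of incident pairs; it passes between sums over edges and sums over
  vertices.\<close>

lemma sum_over_ends:
  assumes "A \<subseteq> E"
  shows "(\<Sum>e\<in>A. \<Sum>x | x \<in> e \<and> Q x. g x e) = (\<Sum>x | x \<in> V \<and> Q x. \<Sum>e\<in>incident E x \<inter> A. g x e)"
proof -
  have fin: "finite A" "finite {x \<in> V. Q x}"
    using assms finite_vertices by (auto intro: finite_subset)
  have "(\<Sum>e\<in>A. \<Sum>x | x \<in> {x \<in> V. Q x} \<and> x \<in> e. g x e)
      = (\<Sum>x | x \<in> V \<and> Q x. \<Sum>e | e \<in> A \<and> x \<in> e. g x e)"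
    by (rule sum.swap_restrict[OF fin])
  also have "(\<Sum>e\<in>A. \<Sum>x | x \<in> {x \<in> V. Q x} \<and> x \<in> e. g x e) = (\<Sum>e\<in>A. \<Sum>x | x \<in> e \<and> Q x. g x e)"
    using assms edge_in_V by (intro sum.cong refl) auto
  also have "(\<Sum>x | x \<in> V \<and> Q x. \<Sum>e | e \<in> A \<and> x \<in> e. g x e)
      = (\<Sum>x | x \<in> V \<and> Q x. \<Sum>e\<in>incident E x \<inter> A. g x e)"
    using assms by (intro sum.cong refl) (auto simp: incident_def)
  finally show ?thesis .
qed

lemma incident_subset: "incident E x \<subseteq> E"
  by (auto simp: incident_def)

lemma incident_nonempty:
  assumes "E \<noteq> {}" "x \<in> V"
  shows "incident E x \<noteq> {}"
proof -
  obtain e where "e \<in> E" using assms by auto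
  then obtain u v where uv: "e = {u, v}" "u \<noteq> v" by (rule edgeE)
  then obtain y where y: "y \<in> V" "y \<noteq> x" using edge_in_V[OF \<open>e \<in> E\<close>] by (metis insertCI)
  from connected[OF assms(2) y(1)] obtain xs where xs: "walk V E xs" "hd xs = x" "last xs = y" by blast
  with y obtain z zs where "xs = x # z # zs"
    by (cases xs; cases "tl xs") (auto simp: walk_def)
  with xs have "{x, z} \<in> E" by (simp add: walk_def)
  then show ?thesis by (auto simp: incident_def)
qed

text \<open>At such vertices \<open>2 - deg\<close> is positive, the wrong sign for the estimates
  below; a star with a single edge turns them into equalities or empty sums.\<close>

lemma incident_pendant:
  assumes "deg E x \<le> 1" "e \<in> incident E x"
  shows "incident E x = {e}"
proof -
  have "0 < deg E x" unfolding deg_def card_gt_0_iff using assms(2) by auto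
  with assms(1) have "deg E x = 1" by linarith
  then obtain f where "incident E x = {f}" by (auto simp: deg_def card_1_singleton_iff)
  with assms(2) show ?thesis by simp
qed

lemma \<beta>_if: "\<beta> V E A = (\<Sum>x\<in>V. if incident E x \<subseteq> A then 2 - real (deg E x) else 0)"
  unfolding \<beta>_def using finite_vertices by (intro sum.inter_filter) auto

context
  fixes p :: "'a set \<Rightarrow> real" and x :: 'a
  assumes p: "\<And>e. e \<in> incident E x \<Longrightarrow> 0 < p e" and nonempty: "incident E x \<noteq> {}"
begin

lemma sum_inverse_pos: "0 < (\<Sum>f\<in>incident E x. inverse (p f))"
  using p nonempty by (intro sum_pos) auto

lemma share_pos: "e \<in> incident E x \<Longrightarrow> 0 < share E p x e"
  using p sum_inverse_pos by (simp add: share_def)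

lemma sum_share: "(\<Sum>e\<in>incident E x. share E p x e) = 1"
  using sum_inverse_pos by (simp add: share_def flip: sum_divide_distrib)

end

text \<open>\<open>b e\<close> is the rate of change of \<open>- ln (p e)\<close>, so the gradient
  of the energy in logarithmic coordinates is curvature minus \<open>c\<close>. The set
  \<open>S\<close> covers both the one-sided derivative of the flow at time 0 and two-sided
  variations.\<close>

lemma energy_has_derivative:
  assumes "C \<subseteq> E" "E \<noteq> {}" and pos: "\<And>e. e \<in> C \<Longrightarrow> 0 < p t e"
    and deriv: "\<And>e. e \<in> C \<Longrightarrow> ((\<lambda>s. p s e) has_real_derivative - p t e * b e) (at t within S)"
  shows "((\<lambda>s. energy V E C c (p s)) has_real_derivative
      (\<Sum>e\<in>C. (restricted_curvature E C (p t) e - c e) * b e)) (at t within S)"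
proof -
  let ?D = "\<lambda>x. \<Sum>f\<in>incident E x. inverse (p t f)"
  have inv: "((\<lambda>s. inverse (p s e)) has_real_derivative inverse (p t e) * b e) (at t within S)"
    if "e \<in> C" for e
    by (rule DERIV_cong[OF DERIV_inverse'[OF deriv[OF that]]]) (use pos[OF that] in auto)
  have "((\<lambda>s. energy V E C c (p s)) has_real_derivative
      (\<Sum>x | x \<in> V \<and> incident E x \<subseteq> C. (2 - real (deg E x)) *
          ((\<Sum>f\<in>incident E x. inverse (p t f) * b f) / ?D x))
      + (\<Sum>e\<in>C. c e * (- p t e * b e / p t e))) (at t within S)"
    unfolding energy_def
  proof (intro DERIV_add DERIV_sum DERIV_cmult)
    fix x assume "x \<in> {x. x \<in> V \<and> incident E x \<subseteq> C}"
    then have x: "x \<in> V" "incident E x \<subseteq> C" by auto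
    then have D: "0 < ?D x" using pos incident_nonempty[OF assms(2)] by (intro sum_inverse_pos) auto
    have d: "((\<lambda>s. \<Sum>f\<in>incident E x. inverse (p s f)) has_real_derivative
        (\<Sum>f\<in>incident E x. inverse (p t f) * b f)) (at t within S)"
      using inv x(2) by (intro DERIV_sum) auto
    show "((\<lambda>s. ln (\<Sum>f\<in>incident E x. inverse (p s f))) has_real_derivative
        (\<Sum>f\<in>incident E x. inverse (p t f) * b f) / ?D x) (at t within S)"
      using DERIV_chain2[OF DERIV_ln_divide[OF D] d] by simp
  next
    fix e assume e: "e \<in> C"
    show "((\<lambda>s. ln (p s e)) has_real_derivative - p t e * b e / p t e) (at t within S)"
      using DERIV_chain2[OF DERIV_ln[OF pos[OF e]] deriv[OF e]] by (simp add: divide_inverse mult.commute)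
  qed
  also have "(\<Sum>x | x \<in> V \<and> incident E x \<subseteq> C. (2 - real (deg E x)) *
          ((\<Sum>f\<in>incident E x. inverse (p t f) * b f) / ?D x))
      = (\<Sum>x | x \<in> V \<and> incident E x \<subseteq> C. \<Sum>e\<in>incident E x \<inter> C.
          (2 - real (deg E x)) * share E (p t) x e * b e)"
    by (intro sum.cong refl)
      (auto simp: share_def sum_distrib_left sum_divide_distrib Int_absorb2 intro!: sum.cong)
  also have "\<dots> = (\<Sum>e\<in>C. \<Sum>x | x \<in> e \<and> incident E x \<subseteq> C. (2 - real (deg E x)) * share E (p t) x e * b e)"
    by (rule sum_over_ends[OF assms(1), symmetric])
  also have "\<dots> = (\<Sum>e\<in>C. restricted_curvature E C (p t) e * b e)"
    by (simp add: restricted_curvature_eq_share sum_distrib_right)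
  also have "(\<Sum>e\<in>C. c e * (- p t e * b e / p t e)) = (\<Sum>e\<in>C. - c e * b e)"
    by (intro sum.cong) (use pos in force)+
  finally show ?thesis by (simp add: left_diff_distrib sum_subtractf sum_negf)
qed

section \<open>The polytope of excess vectors\<close>

lemma edge_distributionsI:
  assumes "\<And>x e. x \<in> V \<Longrightarrow> e \<in> incident E x \<Longrightarrow> 0 \<le> q (x, e)"
    and "\<And>x. x \<in> V \<Longrightarrow> (\<Sum>e\<in>incident E x. q (x, e)) = 1"
    and "\<And>x e. \<not> (x \<in> V \<and> e \<in> incident E x) \<Longrightarrow> q (x, e) = 0"
  shows "q \<in> edge_distributions V E"
proof -
  have "q (x, e) \<le> 1" if "x \<in> V" "e \<in> incident E x" for x e
    using member_le_sum[OF that(2), of "\<lambda>e. q (x, e)"] assms that by auto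
  with assms show ?thesis by (auto simp: edge_distributions_def)
qed

lemma edge_distributionsD:
  assumes "q \<in> edge_distributions V E"
  shows "0 \<le> q (x, e)" "x \<in> V \<Longrightarrow> (\<Sum>e\<in>incident E x. q (x, e)) = 1"
    "\<not> (x \<in> V \<and> e \<in> incident E x) \<Longrightarrow> q (x, e) = 0"
proof -
  have z: "q (x, e) \<in> (if (x, e) \<in> Sigma V (incident E) then {0..1} else {0})"
    using assms unfolding edge_distributions_def by blast
  then show "0 \<le> q (x, e)" "\<not> (x \<in> V \<and> e \<in> incident E x) \<Longrightarrow> q (x, e) = 0"
    by (auto split: if_splits)
  show "x \<in> V \<Longrightarrow> (\<Sum>e\<in>incident E x. q (x, e)) = 1"
    using assms unfolding edge_distributions_def by blast
qed

definition share_distribution :: "('a set \<Rightarrow> real) \<Rightarrow> 'a \<times> 'a set \<Rightarrow> real" where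
  "share_distribution p = (\<lambda>(x, e). if x \<in> V \<and> e \<in> incident E x then share E p x e else 0)"

text \<open>The shares at a vertex sum to 1, so the curvature of every positive metric is a point of
  the polytope.\<close>

lemma share_distribution:
  assumes "E \<noteq> {}" "\<And>e. e \<in> E \<Longrightarrow> 0 < p e"
  shows "share_distribution p \<in> edge_distributions V E"
    and "e \<in> E \<Longrightarrow> excess E (share_distribution p) e = restricted_curvature E E p e"
proof -
  show "share_distribution p \<in> edge_distributions V E"
  proof (rule edge_distributionsI)
    fix x assume x: "x \<in> V"
    have P: "0 < p e" if "e \<in> incident E x" for e using assms(2) that by (auto simp: incident_def)
    show "(\<Sum>e\<in>incident E x. share_distribution p (x, e)) = 1"
      using sum_share[of x p, OF P incident_nonempty[OF assms(1) x]] x by (simp add: share_distribution_def)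
    show "0 \<le> share_distribution p (x, e)" if "e \<in> incident E x" for e
      using share_pos[of x p, OF P incident_nonempty[OF assms(1) x] that] x that
      by (simp add: share_distribution_def)
  qed (auto simp: share_distribution_def)
  assume e: "e \<in> E"
  have "{x. x \<in> e \<and> incident E x \<subseteq> E} = e" by (auto simp: incident_def)
  then show "excess E (share_distribution p) e = restricted_curvature E E p e"
    using e edge_in_V[OF e] unfolding excess_def restricted_curvature_eq_share
    by (intro sum.cong) (auto simp: share_distribution_def incident_def)
qed

lemma sum_excess:
  assumes "A \<subseteq> E"
  shows "(\<Sum>e\<in>A. h e * excess E q e)
    = (\<Sum>x\<in>V. (2 - real (deg E x)) * (\<Sum>e\<in>incident E x \<inter> A. h e * q (x, e)))"
  using sum_over_ends[OF assms, where Q = "\<lambda>_. True" and g = "\<lambda>x e. h e * ((2 - real (deg E x)) * q (x, e))"]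
  by (simp add: excess_def sum_distrib_left mult_ac)

text \<open>Vertex by vertex: a star inside \<open>A\<close> contributes equally to both sides.
  Otherwise a vertex of degree at least 2 contributes at most 0, and the only edge of a leaf lies
  outside \<open>A\<close>.\<close>

lemma sum_excess_le_\<beta>:
  assumes q: "q \<in> edge_distributions V E" and "A \<subseteq> E"
  shows "(\<Sum>e\<in>A. excess E q e) \<le> \<beta> V E A"
proof -
  have "(2 - real (deg E x)) * (\<Sum>e\<in>incident E x \<inter> A. q (x, e))
      \<le> (if incident E x \<subseteq> A then 2 - real (deg E x) else 0)" if x: "x \<in> V" for x
  proof (cases "incident E x \<subseteq> A")
    case True
    with edge_distributionsD(2)[OF q x] show ?thesis by (simp add: Int_absorb2)
  next
    case False
    show ?thesis
    proof (cases "2 \<le> deg E x")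
      case True
      have "0 \<le> (\<Sum>e\<in>incident E x \<inter> A. q (x, e))"
        using edge_distributionsD(1)[OF q] by (intro sum_nonneg) auto
      with True False show ?thesis by (simp add: mult_nonpos_nonneg)
    next
      case deg: False
      have "incident E x \<inter> A = {}"
        using incident_pendant[of x] deg False by fastforce
      with False show ?thesis by simp
    qed
  qed
  then show ?thesis
    using sum_excess[OF assms(2), of "\<lambda>_. 1" q] by (simp add: \<beta>_if sum_mono)
qed

text \<open>All stars lie in \<open>E\<close>. Hence all points of the polytope have the same
  coordinate sum, and common shifts such as \<open>mean_curvature\<close> drop out of the energy
  derivative.\<close>

lemma sum_excess_all:
  assumes "q \<in> edge_distributions V E"
  shows "(\<Sum>e\<in>E. excess E q e) = \<beta> V E E"
  using sum_excess[OF subset_refl, of "\<lambda>_. 1" q] edge_distributionsD(2)[OF assms]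
  by (simp add: \<beta>_if incident_subset Int_absorb2)

text \<open>The reason is that \<open>ln \<Sum>\<^sub>f 1 / p\<^sub>f\<close> is at least every average of the numbers \<open>- ln (p\<^sub>f)\<close>.\<close>

lemma energy_excess_nonpos:
  assumes "E \<noteq> {}" "q \<in> edge_distributions V E" and pos: "\<And>e. e \<in> E \<Longrightarrow> 0 < p e"
  shows "energy V E E (excess E q) p \<le> 0"
proof -
  have "(2 - real (deg E x)) * ln (\<Sum>f\<in>incident E x. inverse (p f))
      + (2 - real (deg E x)) * (\<Sum>e\<in>incident E x. ln (p e) * q (x, e)) \<le> 0" (is "?k * ?l + ?k * ?s \<le> 0")
    if x: "x \<in> V" for x
  proof (cases "2 \<le> deg E x")
    case True
    have ge: "- ln (p e) \<le> ?l" if e: "e \<in> incident E x" for e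
    proof -
      have "inverse (p e) \<le> (\<Sum>f\<in>incident E x. inverse (p f))"
        by (rule member_le_sum[OF e]) (use pos in \<open>auto simp: incident_def intro: less_imp_le\<close>)
      moreover have "0 < p e" using e pos by (simp add: incident_def)
      ultimately have "ln (inverse (p e)) \<le> ?l"
        by (subst ln_le_cancel_iff) (auto intro: less_le_trans[of 0 "inverse (p e)"])
      then show ?thesis using \<open>0 < p e\<close> by (simp add: ln_inverse)
    qed
    have "- ?s = (\<Sum>e\<in>incident E x. (- ln (p e)) * q (x, e))" by (simp add: sum_negf)
    also have "\<dots> \<le> (\<Sum>e\<in>incident E x. ?l * q (x, e))"
      using ge edge_distributionsD(1)[OF assms(2)] by (intro sum_mono mult_right_mono) auto
    also have "\<dots> = ?l" using edge_distributionsD(2)[OF assms(2) x] by (simp flip: sum_distrib_left)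
    finally have "0 \<le> ?l + ?s" by simp
    with True have "?k * (?l + ?s) \<le> 0" by (simp add: mult_nonpos_nonneg)
    then show ?thesis by (simp add: distrib_left)
  next
    case False
    \<comment> \<open>At a leaf the coefficient is positive, but logarithm and average agree and the
      two terms cancel.\<close>
    obtain e where e: "e \<in> incident E x" using incident_nonempty[OF assms(1) x] by auto
    with False incident_pendant[of x e] have inc: "incident E x = {e}" by simp
    moreover have "q (x, e) = 1" using edge_distributionsD(2)[OF assms(2) x] inc by simp
    moreover have "0 < p e" using e pos by (simp add: incident_def)
    ultimately show ?thesis by (simp add: ln_inverse)
  qed
  then have "(\<Sum>x\<in>V. (2 - real (deg E x)) * ln (\<Sum>f\<in>incident E x. inverse (p f))
      + (2 - real (deg E x)) * (\<Sum>e\<in>incident E x. ln (p e) * q (x, e))) \<le> 0"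
    by (rule sum_nonpos)
  then show ?thesis
    using sum_excess[OF subset_refl, of "\<lambda>e. ln (p e)" q]
    by (simp add: energy_def incident_subset Int_absorb2 sum.distrib mult.commute)
qed

section \<open>The point of minimal norm\<close>

definition min_norm :: "('a \<times> 'a set \<Rightarrow> real) \<Rightarrow> bool" where
  "min_norm q \<longleftrightarrow> q \<in> edge_distributions V E \<and>
    (\<forall>q'\<in>edge_distributions V E. (\<Sum>e\<in>E. (excess E q e)\<^sup>2) \<le> (\<Sum>e\<in>E. (excess E q' e)\<^sup>2))"

lemma min_norm_exists:
  assumes "E \<noteq> {}"
  obtains q where "min_norm q"
proof -
  let ?B = "{q. \<forall>z. q z \<in> (if z \<in> Sigma V (incident E) then {0..1} else {0 :: real})}"
  let ?S = "\<Inter>x\<in>V. {q :: 'a \<times> 'a set \<Rightarrow> real. (\<Sum>e\<in>incident E x. q (x, e)) = 1}"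
  have "compact ?B" by (rule compact_Pi_UNIV) auto
  moreover have "closed ?S"
    by (intro closed_INT ballI closed_Collect_eq continuous_intros continuous_on_product_coordinates)
  ultimately have "compact (?B \<inter> ?S)" by (rule compact_Int_closed)
  moreover have "?B \<inter> ?S = edge_distributions V E" by (auto simp: edge_distributions_def)
  ultimately have "compact (edge_distributions V E)" by simp
  moreover have "edge_distributions V E \<noteq> {}"
    using share_distribution(1)[OF assms, of "\<lambda>_. 1"] by auto
  moreover have "continuous_on (edge_distributions V E) (\<lambda>q. \<Sum>e\<in>E. (excess E q e)\<^sup>2)"
    unfolding excess_def
    by (intro continuous_intros continuous_on_subset[OF continuous_on_product_coordinates]) auto
  ultimately show thesis
    using continuous_attains_inf[of "edge_distributions V E" "\<lambda>q. \<Sum>e\<in>E. (excess E q e)\<^sup>2"] that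
    by (auto simp: min_norm_def)
qed

text \<open>First-order condition along the segment from \<open>q\<close> to \<open>q'\<close>,
  which stays in the convex set of distributions.\<close>

lemma min_norm_variational:
  assumes q: "min_norm q" and q': "q' \<in> edge_distributions V E"
  shows "0 \<le> (\<Sum>e\<in>E. excess E q e * (excess E q' e - excess E q e))"
proof (rule nonneg_if_perturbation_nonneg)
  fix \<tau> :: real assume \<tau>: "0 < \<tau>" "\<tau> \<le> 1"
  have qD: "q \<in> edge_distributions V E" using q by (simp add: min_norm_def)
  define r where "r z = (1 - \<tau>) * q z + \<tau> * q' z" for z
  have "r \<in> edge_distributions V E"
  proof (rule edge_distributionsI)
    show "0 \<le> r (x, e)" for x e
      using \<tau> edge_distributionsD(1)[OF qD] edge_distributionsD(1)[OF q'] by (simp add: r_def)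
    show "(\<Sum>e\<in>incident E x. r (x, e)) = 1" if "x \<in> V" for x
      using edge_distributionsD(2)[OF qD that] edge_distributionsD(2)[OF q' that]
      by (simp add: r_def sum.distrib flip: sum_distrib_left)
    show "r (x, e) = 0" if "\<not> (x \<in> V \<and> e \<in> incident E x)" for x e
      using edge_distributionsD(3)[OF qD that] edge_distributionsD(3)[OF q' that] by (simp add: r_def)
  qed
  then have "(\<Sum>e\<in>E. (excess E q e)\<^sup>2) \<le> (\<Sum>e\<in>E. (excess E r e)\<^sup>2)"
    using q by (simp add: min_norm_def)
  moreover have er: "excess E r e = excess E q e + \<tau> * (excess E q' e - excess E q e)" for e
    unfolding excess_def
    by (simp add: r_def sum.distrib sum_subtractf sum_distrib_left algebra_simps)
  have "(excess E r e)\<^sup>2 = (excess E q e)\<^sup>2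
      + 2 * \<tau> * (excess E q e * (excess E q' e - excess E q e))
      + \<tau>\<^sup>2 * (excess E q' e - excess E q e)\<^sup>2" for e
    unfolding er by (simp add: power2_eq_square algebra_simps)
  then have "(\<Sum>e\<in>E. (excess E r e)\<^sup>2) = (\<Sum>e\<in>E. (excess E q e)\<^sup>2)
      + 2 * \<tau> * (\<Sum>e\<in>E. excess E q e * (excess E q' e - excess E q e))
      + \<tau>\<^sup>2 * (\<Sum>e\<in>E. (excess E q' e - excess E q e)\<^sup>2)"
    by (simp add: sum.distrib flip: sum_distrib_left)
  ultimately show "0 \<le> 2 * \<tau> * (\<Sum>e\<in>E. excess E q e * (excess E q' e - excess E q e))
      + \<tau>\<^sup>2 * (\<Sum>e\<in>E. (excess E q' e - excess E q e)\<^sup>2)"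
    by simp
qed

text \<open>Otherwise moving mass from \<open>e\<close> to \<open>f\<close> would decrease the norm.\<close>

lemma min_norm_support:
  assumes q: "min_norm q" and x: "x \<in> V" "3 \<le> deg E x"
    and ef: "e \<in> incident E x" "f \<in> incident E x" "excess E q e < excess E q f"
  shows "q (x, e) = 0"
proof -
  have qD: "q \<in> edge_distributions V E" using q by (simp add: min_norm_def)
  have ne: "e \<noteq> f" using ef by auto
  \<comment> \<open>All mass that \<open>q\<close> puts on \<open>e\<close> at \<open>x\<close> is
    moved to \<open>f\<close>.\<close>
  define d where "d e' = (if e' = f then q (x, e) else 0) - (if e' = e then q (x, e) else 0)" for e'
  define q' where "q' = (\<lambda>(x', e'). q (x', e') + (if x' = x then d e' else 0))"
  have q': "q' \<in> edge_distributions V E"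
  proof (rule edge_distributionsI)
    show "0 \<le> q' (y, e')" for y e'
      using edge_distributionsD(1)[OF qD] ne by (auto simp: q'_def d_def)
    show "(\<Sum>e\<in>incident E y. q' (y, e)) = 1" if "y \<in> V" for y
      using edge_distributionsD(2)[OF qD that] ef
      by (cases "y = x") (simp_all add: q'_def d_def sum.distrib sum_subtractf)
    show "q' (y, e') = 0" if "\<not> (y \<in> V \<and> e' \<in> incident E y)" for y e'
      using edge_distributionsD(3)[OF qD that] that x ef by (auto simp: q'_def d_def)
  qed
  have "(\<Sum>e\<in>E. excess E q e * (excess E q' e - excess E q e))
      = (\<Sum>y\<in>V. (2 - real (deg E y)) * (\<Sum>e'\<in>incident E y. excess E q e' * (q' (y, e') - q (y, e'))))"
    using sum_excess[OF subset_refl, of "excess E q" q'] sum_excess[OF subset_refl, of "excess E q" q]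
    by (simp add: incident_subset Int_absorb2 right_diff_distrib sum_subtractf)
  also have "\<dots> = (\<Sum>y\<in>V. if y = x
      then (2 - real (deg E x)) * (\<Sum>e'\<in>incident E x. excess E q e' * d e') else 0)"
    by (intro sum.cong refl) (auto simp: q'_def)
  also have "\<dots> = (2 - real (deg E x)) * (\<Sum>e'\<in>incident E x. excess E q e' * d e')"
    using x finite_vertices by simp
  also have "(\<Sum>e'\<in>incident E x. excess E q e' * d e')
      = (\<Sum>e'\<in>incident E x. (if e' = f then excess E q f * q (x, e) else 0)
          - (if e' = e then excess E q e * q (x, e) else 0))"
    by (intro sum.cong refl) (auto simp: d_def)
  also have "\<dots> = (excess E q f - excess E q e) * q (x, e)"
    using ef by (simp add: sum_subtractf left_diff_distrib)
  finally have "0 \<le> (2 - real (deg E x)) * ((excess E q f - excess E q e) * q (x, e))"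
    using min_norm_variational[OF q q'] by simp
  \<comment> \<open>The coefficient is negative because the degree is at least 3.\<close>
  then have "(excess E q f - excess E q e) * q (x, e) \<le> 0"
    using x by (simp add: zero_le_mult_iff)
  with ef edge_distributionsD(1)[OF qD, of x e] show ?thesis
    by (simp add: mult_le_0_iff)
qed

text \<open>The estimate behind \<open>sum_excess_le_\<beta>\<close> is sharp at each vertex. If the
  star of a vertex of degree at least 3 has an edge outside \<open>A\<close>, that edge has larger
  excess, so edges of the star in \<open>A\<close> carry no mass.\<close>

lemma min_norm_tight:
  assumes "E \<noteq> {}" "min_norm q"
  defines "A \<equiv> {e \<in> E. excess E q e = Min (excess E q ` E)}"
  shows "(\<Sum>e\<in>A. excess E q e) = \<beta> V E A"
proof -
  have qD: "q \<in> edge_distributions V E" using assms by (simp add: min_norm_def)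
  have AE: "A \<subseteq> E" by (auto simp: A_def)
  have "(2 - real (deg E x)) * (\<Sum>e\<in>incident E x \<inter> A. q (x, e))
      = (if incident E x \<subseteq> A then 2 - real (deg E x) else 0)" if x: "x \<in> V" for x
  proof (cases "incident E x \<subseteq> A")
    case True
    with edge_distributionsD(2)[OF qD x] show ?thesis by (simp add: Int_absorb2)
  next
    case False
    then obtain f where f: "f \<in> incident E x" "f \<notin> A" by auto
    consider "deg E x \<le> 1" | "deg E x = 2" | "3 \<le> deg E x" by linarith
    then show ?thesis
    proof cases
      case 1
      then have "incident E x \<inter> A = {}" using incident_pendant[OF 1 f(1)] f by simp
      with False show ?thesis by simp
    next
      case 3
      have "q (x, e) = 0" if "e \<in> incident E x \<inter> A" for e
      proof (rule min_norm_support[OF assms(2) x 3 _ f(1)])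
        have "f \<in> E" using f by (simp add: incident_def)
        moreover from this have "Min (excess E q ` E) \<le> excess E q f" by simp
        ultimately show "excess E q e < excess E q f"
          using that f(2) by (auto simp: A_def simp del: Min_le Min_le_iff)
      qed (use that in auto)
      then show ?thesis using False by simp
    qed (use False in simp)
  qed
  then show ?thesis
    using sum_excess[OF AE, of "\<lambda>_. 1" q] by (simp add: \<beta>_if)
qed

text \<open>Derivative of a softmax: each share is multiplied by the deviation of \<open>b e\<close>
  from the mean of \<open>b\<close> under the shares.\<close>

lemma restricted_curvature_has_derivative:
  assumes "E \<noteq> {}" "e \<in> E" and pos: "\<And>e. e \<in> E \<Longrightarrow> 0 < p t e"
    and deriv: "\<And>e. e \<in> E \<Longrightarrow> ((\<lambda>s. p s e) has_real_derivative - p t e * b e) (at t within S)"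
  shows "((\<lambda>s. restricted_curvature E E (p s) e) has_real_derivative
      (\<Sum>x | x \<in> e \<and> incident E x \<subseteq> E. (2 - real (deg E x)) * (share E (p t) x e *
         (b e - (\<Sum>f\<in>incident E x. share E (p t) x f * b f))))) (at t within S)"
  unfolding restricted_curvature_eq_share
proof (intro DERIV_sum DERIV_cmult)
  fix x assume "x \<in> {x. x \<in> e \<and> incident E x \<subseteq> E}"
  then have x: "x \<in> V" "e \<in> incident E x" using edge_in_V assms(2) by (auto simp: incident_def)
  let ?D = "\<lambda>s. \<Sum>f\<in>incident E x. inverse (p s f)"
  have inv: "((\<lambda>s. inverse (p s e)) has_real_derivative inverse (p t e) * b e) (at t within S)"
    if "e \<in> E" for e
    by (rule DERIV_cong[OF DERIV_inverse'[OF deriv[OF that]]]) (use pos[OF that] in auto)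
  have D: "0 < ?D t" using pos x(2) by (intro sum_inverse_pos) (auto simp: incident_def)
  have quot: "(i * a * d - i * c) / (d * d) = i / d * (a - c / d)" if "0 < d" for i a c d :: real
    using that by (simp add: field_simps)
  have "(?D has_real_derivative (\<Sum>f\<in>incident E x. inverse (p t f) * b f)) (at t within S)"
    using inv incident_subset[of x] by (intro DERIV_sum) auto
  then have "((\<lambda>s. share E (p s) x e) has_real_derivative
      (inverse (p t e) * b e * ?D t - inverse (p t e) * (\<Sum>f\<in>incident E x. inverse (p t f) * b f))
        / (?D t * ?D t)) (at t within S)"
    unfolding share_def using D by (intro DERIV_divide inv assms(2)) auto
  also have "(inverse (p t e) * b e * ?D t - inverse (p t e) * (\<Sum>f\<in>incident E x. inverse (p t f) * b f))
        / (?D t * ?D t) = inverse (p t e) / ?D t * (b e - (\<Sum>f\<in>incident E x. inverse (p t f) * b f) / ?D t)"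
    using quot[OF D] .
  also have "\<dots> = share E (p t) x e * (b e - (\<Sum>f\<in>incident E x. share E (p t) x f * b f))"
    by (simp add: share_def sum_divide_distrib)
  finally show "((\<lambda>s. share E (p s) x e) has_real_derivative
      share E (p t) x e * (b e - (\<Sum>f\<in>incident E x. share E (p t) x f * b f))) (at t within S)" .
qed

end

section \<open>Convergence of the flow\<close>

text \<open>Two-sided derivatives on the open interval suffice; at the endpoint 0 the one-sided
  derivative still provides continuity.\<close>

lemma nondecreasing_if_derivative_nonneg:
  fixes f f' :: "real \<Rightarrow> real"
  assumes "\<And>t. 0 \<le> t \<Longrightarrow> (f has_real_derivative f' t) (at t within {0..})"
    and "0 \<le> a" "a \<le> b" "\<And>t. a \<le> t \<Longrightarrow> t \<le> b \<Longrightarrow> 0 \<le> f' t"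
  shows "f a \<le> f b"
proof (rule DERIV_nonneg_imp_increasing_open[OF assms(3)])
  fix t assume t: "a < t" "t < b"
  then have "at t within {0..} = at t"
    using assms(2) by (intro at_within_open_subset[of t "{0<..}"]) auto
  with assms t show "\<exists>y. (f has_real_derivative y) (at t) \<and> 0 \<le> y" by (metis less_imp_le order_trans)
next
  have "continuous_on {0..} f"
    using assms(1) by (intro DERIV_continuous_on) auto
  then show "continuous_on {a..b} f"
    by (rule continuous_on_subset) (use assms in auto)
qed

section \<open>Decay of the curvature norm and growth of the energy\<close>

context finite_tree
begin

context
  fixes w :: "real \<Rightarrow> 'a set \<Rightarrow> real"
  assumes flow: "normalized_flow V E w" and nonempty: "E \<noteq> {}"
begin

abbreviation (input) "\<kappa> t \<equiv> restricted_curvature E E (w t)"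

lemma flow_pos: "0 \<le> t \<Longrightarrow> e \<in> E \<Longrightarrow> 0 < w t e"
  using flow by (simp add: normalized_flow_def)

lemma flow_derivative:
  assumes "0 \<le> t" "e \<in> E"
  shows "((\<lambda>s. w s e) has_real_derivative - w t e * (\<kappa> t e - mean_curvature V E (w t))) (at t within {0..})"
proof -
  have "((\<lambda>s. w s e) has_real_derivative
      - w t e * (edge_curvature V E (w t) e - mean_curvature V E (w t))) (at t within {0..})"
    using flow assms unfolding normalized_flow_def by blast
  then show ?thesis using edge_curvature_eq[of "w t" e] flow_pos assms by simp
qed

text \<open>Half the derivative of the squared norm is a sum over vertices of \<open>2 - deg\<close>
  times the variance of the curvature under the shares; at a leaf this variance is 0.\<close>

lemma curvature_norm_nonincreasing:
  assumes "0 \<le> a" "a \<le> b"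
  shows "(\<Sum>e\<in>E. (\<kappa> b e)\<^sup>2) \<le> (\<Sum>e\<in>E. (\<kappa> a e)\<^sup>2)"
proof -
  define k' where "k' t e = (\<Sum>x | x \<in> e \<and> incident E x \<subseteq> E. (2 - real (deg E x)) * (share E (w t) x e *
       (\<kappa> t e - mean_curvature V E (w t)
         - (\<Sum>f\<in>incident E x. share E (w t) x f * (\<kappa> t f - mean_curvature V E (w t))))))" for t e
  define N where "N t = - (\<Sum>e\<in>E. (\<kappa> t e)\<^sup>2)" for t
  have "N a \<le> N b"
  proof (rule nondecreasing_if_derivative_nonneg[OF _ assms])
    fix t :: real assume t: "0 \<le> t"
    have "((\<lambda>s. \<kappa> s e) has_real_derivative k' t e) (at t within {0..})" if "e \<in> E" for e
      unfolding k'_def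
      by (rule restricted_curvature_has_derivative[OF nonempty that]) (use flow_pos flow_derivative t in auto)
    then show "(N has_real_derivative - (\<Sum>e\<in>E. 2 * \<kappa> t e * k' t e)) (at t within {0..})"
      unfolding N_def
      by (auto intro!: derivative_eq_intros sum.cong)
  next
    fix t assume "a \<le> t" "t \<le> b"
    then have t: "0 \<le> t" using assms by simp
    define b where "b e = \<kappa> t e - mean_curvature V E (w t)" for e
    have "(\<Sum>e\<in>E. \<kappa> t e * k' t e) = (\<Sum>e\<in>E. \<Sum>x | x \<in> e \<and> incident E x \<subseteq> E. (2 - real (deg E x)) *
        (\<kappa> t e * (share E (w t) x e * (b e - (\<Sum>f\<in>incident E x. share E (w t) x f * b f)))))"
      by (simp add: k'_def b_def sum_distrib_left mult_ac)
    also have "\<dots> = (\<Sum>x | x \<in> V \<and> incident E x \<subseteq> E. (2 - real (deg E x)) * (\<Sum>e\<in>incident E x.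
        (\<kappa> t e * (share E (w t) x e * (b e - (\<Sum>f\<in>incident E x. share E (w t) x f * b f))))))"
      by (subst sum_over_ends) (simp_all add: sum_distrib_left Int_absorb2 incident_subset)
    also have "\<dots> \<le> 0"
    proof (rule sum_nonpos)
      fix x assume "x \<in> {x. x \<in> V \<and> incident E x \<subseteq> E}"
      then have ne: "incident E x \<noteq> {}" using incident_nonempty nonempty by simp
      have P: "0 < w t e" if "e \<in> incident E x" for e using that t flow_pos by (simp add: incident_def)
      note sh = share_pos[of x "w t", OF P ne] sum_share[of x "w t", OF P ne]
      show "(2 - real (deg E x)) * (\<Sum>e\<in>incident E x.
        (\<kappa> t e * (share E (w t) x e * (b e - (\<Sum>f\<in>incident E x. share E (w t) x f * b f))))) \<le> 0"
      proof (cases "2 \<le> deg E x")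
        case True
        \<comment> \<open>\<open>b e + mean_curvature V E (w t)\<close> is the curvature itself, so
          the sum is a covariance of two functions differing by a constant.\<close>
        have "0 \<le> (\<Sum>e\<in>incident E x. (b e + mean_curvature V E (w t)) *
            (share E (w t) x e * (b e - (\<Sum>f\<in>incident E x. share E (w t) x f * b f))))"
          using sh by (intro weighted_covariance_nonneg) (auto intro: less_imp_le)
        with True show ?thesis by (simp add: b_def mult_nonpos_nonneg)
      next
        case False
        obtain e where "e \<in> incident E x" using ne by auto
        with False incident_pendant[of x e] have "incident E x = {e}" by simp
        with sh(2) show ?thesis by simp
      qed
    qed
    finally show "0 \<le> - (\<Sum>e\<in>E. 2 * \<kappa> t e * k' t e)"
      by (simp add: mult.assoc flip: sum_distrib_left)
  qed
  then show ?thesis by (simp add: N_def)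
qed

text \<open>The squared distance is at most \<phi>(t) by the variational inequality. The energy
  grows at rate at least \<phi>(t)/2 on [0, t] and ends at most at 0, which bounds t
  \<phi>(t).\<close>

lemma curvature_distance_le:
  assumes q: "min_norm q" and t: "0 < t"
  shows "(\<Sum>e\<in>E. (\<kappa> t e - excess E q e)\<^sup>2) \<le> - 2 * energy V E E (excess E q) (w 0) / t"
proof -
  let ?c = "excess E q" and ?H = "\<lambda>t. energy V E E (excess E q) (w t)"
  define \<phi> where "\<phi> t = (\<Sum>e\<in>E. (\<kappa> t e)\<^sup>2) - (\<Sum>e\<in>E. (?c e)\<^sup>2)" for t
  have qD: "q \<in> edge_distributions V E" using q by (simp add: min_norm_def)
  have sums: "(\<Sum>e\<in>E. \<kappa> s e - ?c e) = 0" and var: "0 \<le> (\<Sum>e\<in>E. ?c e * (\<kappa> s e - ?c e))" if "0 \<le> s" for s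
  proof -
    note sd = share_distribution[OF nonempty flow_pos[OF that]]
    show "(\<Sum>e\<in>E. \<kappa> s e - ?c e) = 0"
      using sum_excess_all[OF sd(1)] sum_excess_all[OF qD] sd(2) by (simp add: sum_subtractf)
    show "0 \<le> (\<Sum>e\<in>E. ?c e * (\<kappa> s e - ?c e))"
      using min_norm_variational[OF q sd(1)] sd(2) by simp
  qed
  have dist: "(\<Sum>e\<in>E. (\<kappa> s e - ?c e)\<^sup>2) = \<phi> s - 2 * (\<Sum>e\<in>E. ?c e * (\<kappa> s e - ?c e))" for s
    by (simp add: \<phi>_def power2_diff sum.distrib sum_subtractf sum_distrib_left algebra_simps power2_eq_square)
  \<comment> \<open>The growth rate is frozen at the final time \<open>t\<close>, where \<phi> is
    smallest on [0, t].\<close>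
  have "?H 0 - \<phi> t / 2 * 0 \<le> ?H t - \<phi> t / 2 * t"
  proof (rule nondecreasing_if_derivative_nonneg[where a = 0 and b = t])
    fix s :: real assume s: "0 \<le> s"
    have "(?H has_real_derivative
        (\<Sum>e\<in>E. (\<kappa> s e - ?c e) * (\<kappa> s e - mean_curvature V E (w s)))) (at s within {0..})"
      by (rule energy_has_derivative) (use nonempty s flow_pos flow_derivative in auto)
    also have "(\<Sum>e\<in>E. (\<kappa> s e - ?c e) * (\<kappa> s e - mean_curvature V E (w s)))
        = (\<Sum>e\<in>E. (\<kappa> s e - ?c e) * \<kappa> s e)"
      using sums[OF s] by (simp add: right_diff_distrib sum_subtractf flip: sum_distrib_right)
    finally show "((\<lambda>s. ?H s - \<phi> t / 2 * s) has_real_derivative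
        (\<Sum>e\<in>E. (\<kappa> s e - ?c e) * \<kappa> s e) - \<phi> t / 2) (at s within {0..})"
      by (auto intro!: derivative_eq_intros)
  next
    fix s assume s: "0 \<le> s" "s \<le> t"
    have "\<phi> t \<le> \<phi> s" using curvature_norm_nonincreasing[OF s] by (simp add: \<phi>_def)
    moreover have "2 * (\<Sum>e\<in>E. (\<kappa> s e - ?c e) * \<kappa> s e) = \<phi> s + (\<Sum>e\<in>E. (\<kappa> s e - ?c e)\<^sup>2)"
      by (simp add: \<phi>_def power2_diff sum.distrib sum_subtractf sum_distrib_left algebra_simps power2_eq_square)
    moreover have "0 \<le> (\<Sum>e\<in>E. (\<kappa> s e - ?c e)\<^sup>2)" by (simp add: sum_nonneg)
    ultimately show "0 \<le> (\<Sum>e\<in>E. (\<kappa> s e - ?c e) * \<kappa> s e) - \<phi> t / 2" by linarith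
  qed (use t in auto)
  moreover have "?H t \<le> 0"
    by (rule energy_excess_nonpos[OF nonempty qD]) (use flow_pos t in auto)
  ultimately have "\<phi> t * t \<le> - 2 * ?H 0" by simp
  then have "\<phi> t \<le> - 2 * ?H 0 / t" by (subst pos_le_divide_eq[OF t])
  with dist[of t] var[of t] t show ?thesis by linarith
qed

lemma curvature_tendsto:
  assumes q: "min_norm q" and e: "e \<in> E"
  shows "((\<lambda>t. edge_curvature V E (w t) e) \<longlongrightarrow> excess E q e) at_top"
proof -
  have ev: "\<forall>\<^sub>F t :: real in at_top. 0 < t" by (rule eventually_gt_at_top)
  let ?M = "- 2 * energy V E E (excess E q) (w 0)"
  have "((\<lambda>t. (\<kappa> t e - excess E q e)\<^sup>2) \<longlongrightarrow> 0) at_top"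
  proof (rule tendsto_sandwich[where f = "\<lambda>_. 0" and h = "\<lambda>t. ?M / t"])
    show "((\<lambda>t. ?M / t) \<longlongrightarrow> 0) at_top"
      by (rule tendsto_divide_0[OF tendsto_const])
        (simp add: filterlim_at_top_imp_at_infinity filterlim_ident)
    show "\<forall>\<^sub>F t in at_top. (\<kappa> t e - excess E q e)\<^sup>2 \<le> ?M / t"
      using ev
    proof eventually_elim
      case (elim t)
      have "(\<kappa> t e - excess E q e)\<^sup>2 \<le> (\<Sum>e\<in>E. (\<kappa> t e - excess E q e)\<^sup>2)"
        using e by (intro member_le_sum[where f = "\<lambda>e. (\<kappa> t e - excess E q e)\<^sup>2"]) auto
      also have "\<dots> \<le> ?M / t" by (rule curvature_distance_le[OF q elim])
      finally show ?case .
    qed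
  qed auto
  from tendsto_real_sqrt[OF this] have "((\<lambda>t. \<kappa> t e - excess E q e) \<longlongrightarrow> 0) at_top"
    by (simp add: tendsto_rabs_zero_iff)
  then have "((\<lambda>t. \<kappa> t e) \<longlongrightarrow> excess E q e) at_top" by (rule LIM_zero_cancel)
  moreover have "\<forall>\<^sub>F t in at_top. \<kappa> t e = edge_curvature V E (w t) e"
    using ev by eventually_elim (use edge_curvature_eq[OF _ e] flow_pos in auto)
  ultimately show ?thesis using tendsto_cong by fast
qed

end

end

section \<open>Metrics of constant curvature\<close>

text \<open>Only ratios of weights on \<open>C\<close> enter. This allows metrics found on separate
  components to be normalized by one common factor.\<close>

lemma restricted_curvature_scale:
  assumes "k \<noteq> 0" "e \<in> C" "\<And>f. f \<in> C \<Longrightarrow> p' f = k * p f"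
  shows "restricted_curvature E C p' e = restricted_curvature E C p e"
  unfolding restricted_curvature_def
proof (intro sum.cong refl)
  fix x assume x: "x \<in> {x. x \<in> e \<and> incident E x \<subseteq> C}"
  have "(\<Sum>f\<in>incident E x. inverse (p' f)) = (\<Sum>f\<in>incident E x. inverse k * inverse (p f))"
    using x assms(3) by (intro sum.cong) auto
  also have "\<dots> = inverse k * (\<Sum>f\<in>incident E x. inverse (p f))" by (simp add: sum_distrib_left)
  finally have "p' e * (\<Sum>f\<in>incident E x. inverse (p' f)) = p e * (\<Sum>f\<in>incident E x. inverse (p f))"
    using assms by simp
  then show "(2 - real (deg E x)) / (p' e * (\<Sum>f\<in>incident E x. inverse (p' f)))
      = (2 - real (deg E x)) / (p e * (\<Sum>f\<in>incident E x. inverse (p f)))" by simp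
qed

context finite_tree
begin

context
  fixes C :: "'a set set" and c :: real
  assumes C: "C \<subseteq> E" "C \<noteq> {}" and tight: "\<beta> V E C = c * card C"
begin

section \<open>Coercivity of the energy on a tight edge set\<close>

definition log_energy :: "('a set \<Rightarrow> real) \<Rightarrow> real" where
  "log_energy s = energy V E C (\<lambda>_. c) (\<lambda>e. exp (- s e))"

text \<open>The piecewise linear version of \<open>log_energy\<close>, with the maximum in place of
  the logarithm of the sum of exponentials.\<close>

definition max_energy :: "('a set \<Rightarrow> real) \<Rightarrow> real" where
  "max_energy s = (\<Sum>x | x \<in> V \<and> incident E x \<subseteq> C. (2 - real (deg E x)) * Max (s ` incident E x))
     - c * (\<Sum>e\<in>C. s e)"

lemma finite_C: "finite C"
  using C(1) by (rule finite_subset) simp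

lemma E_nonempty: "E \<noteq> {}"
  using C by auto

lemma log_energy_eq: "log_energy s =
    (\<Sum>x | x \<in> V \<and> incident E x \<subseteq> C. (2 - real (deg E x)) * ln (\<Sum>f\<in>incident E x. exp (s f)))
      - c * (\<Sum>e\<in>C. s e)"
  by (simp add: log_energy_def energy_def exp_minus ln_inverse sum_negf sum_distrib_left)

lemma log_energy_cong: "(\<And>e. e \<in> C \<Longrightarrow> s e = s' e) \<Longrightarrow> log_energy s = log_energy s'"
  unfolding log_energy_eq
  by (intro arg_cong2[where f = minus] sum.cong arg_cong2[where f = times] arg_cong[where f = ln] refl) auto

text \<open>A shift by \<open>k\<close> adds \<open>k\<close> times the difference of the two sides
  of \<open>tight\<close>.\<close>

lemma log_energy_shift: "log_energy (\<lambda>e. s e + k) = log_energy s"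
proof -
  have "ln (\<Sum>f\<in>incident E x. exp (s f + k)) = ln (\<Sum>f\<in>incident E x. exp (s f)) + k" if "x \<in> V" for x
  proof -
    have "(\<Sum>f\<in>incident E x. exp (s f + k)) = (\<Sum>f\<in>incident E x. exp (s f)) * exp k"
      by (simp add: exp_add sum_distrib_right)
    moreover have "0 < (\<Sum>f\<in>incident E x. exp (s f))"
      using incident_nonempty[OF E_nonempty that] by (intro sum_pos) auto
    ultimately show ?thesis by (simp add: ln_mult)
  qed
  then have "log_energy (\<lambda>e. s e + k) = log_energy s + k * (\<beta> V E C - c * card C)"
    by (simp add: log_energy_eq \<beta>_def sum.distrib distrib_left sum_distrib_left right_diff_distrib mult_ac)
  with tight show ?thesis by simp
qed

text \<open>The logarithm dominates the maximum and is multiplied by a nonpositive number, except at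
  a leaf, where the two coincide.\<close>

lemma log_energy_le_max_energy: "log_energy s \<le> max_energy s"
proof -
  have "(2 - real (deg E x)) * ln (\<Sum>f\<in>incident E x. exp (s f))
      \<le> (2 - real (deg E x)) * Max (s ` incident E x)" if x: "x \<in> V" for x
  proof (cases "2 \<le> deg E x")
    case True
    have "Max (s ` incident E x) \<in> s ` incident E x"
      using incident_nonempty[OF E_nonempty x] by (intro Max_in) auto
    then obtain e where e: "e \<in> incident E x" "Max (s ` incident E x) = s e" by auto
    have le: "exp (s e) \<le> (\<Sum>f\<in>incident E x. exp (s f))"
      by (rule member_le_sum[OF e(1)]) auto
    have "ln (exp (s e)) \<le> ln (\<Sum>f\<in>incident E x. exp (s f))"
      by (subst ln_le_cancel_iff) (use le in \<open>auto intro: less_le_trans[of 0 "exp (s e)"]\<close>)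
    with True e(2) show ?thesis by (intro mult_left_mono_neg) auto
  next
    case False
    obtain e where "e \<in> incident E x" using incident_nonempty[OF E_nonempty x] by auto
    with False incident_pendant[of x e] have "incident E x = {e}" by simp
    then show ?thesis by simp
  qed
  then show ?thesis unfolding log_energy_eq max_energy_def by (intro diff_right_mono sum_mono) auto
qed

text \<open>Coercivity. Lowering the top level of \<open>s\<close>, attained on \<open>C - A\<close>, to the next one by \<open>h\<close>
  increases \<open>max_energy\<close> by \<open>h (\<beta>(A) - c |A|)\<close>, because \<open>Max (s ` E(x))\<close> drops exactly when
  \<open>E(x)\<close> is not contained in \<open>A\<close>.\<close>

lemma max_energy_le:
  assumes gap: "\<And>A. A \<noteq> {} \<Longrightarrow> A \<subset> C \<Longrightarrow> \<delta> \<le> \<beta> V E A - c * card A" and "0 < \<delta>"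
    and "e \<in> C" "f \<in> C"
  shows "max_energy s \<le> - \<delta> * (s e - s f)"
  using assms(3,4)
proof (induction "card (s ` C)" arbitrary: s e f rule: less_induct)
  \<comment> \<open>The induction is on the number of values that \<open>s\<close> takes on
    \<open>C\<close>; merging the two highest levels lowers it.\<close>
  case less
  define M where "M = Max (s ` C)"
  define A where "A = {e \<in> C. s e < M}"
  have le_M: "s e \<le> M" if "e \<in> C" for e using that finite_C by (simp add: M_def)
  have "M \<in> s ` C" unfolding M_def using finite_C C(2) by (intro Max_in) auto
  then obtain top where top: "top \<in> C" "s top = M" by auto
  have AC: "A \<subset> C" using top by (auto simp: A_def)
  have finA: "finite A" using AC finite_C finite_subset by blast
  show ?case
  proof (cases "A = {}")
    case True
    then have const: "s e = M" if "e \<in> C" for e using that le_M[OF that] by (force simp: A_def)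
    have "Max (s ` incident E x) = M" if "x \<in> V" "incident E x \<subseteq> C" for x
    proof -
      have "s ` incident E x = {M}" using incident_nonempty[OF E_nonempty that(1)] that(2) const by force
      then show ?thesis by simp
    qed
    then have "max_energy s = M * (\<beta> V E C - c * card C)"
      using const by (simp add: max_energy_def \<beta>_def sum_distrib_left right_diff_distrib mult_ac)
    with less.prems const tight show ?thesis by simp
  next
    case False
    define M' where "M' = Max (s ` A)"
    define s' where "s' e = min (s e) M'" for e
    have le_M': "s e \<le> M'" if "e \<in> A" for e using that finA by (simp add: M'_def)
    have "M' \<in> s ` A" unfolding M'_def using finA False by (intro Max_in) auto
    then obtain a where a: "a \<in> A" "s a = M'" by auto
    have M'M: "M' < M" using a by (auto simp: A_def)
    have sA: "s' e = s e" if "e \<in> A" for e using le_M'[OF that] by (simp add: s'_def)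
    have sC: "s e = M" "s' e = M'" if "e \<in> C" "e \<notin> A" for e
      using that le_M[of e] M'M by (auto simp: A_def s'_def)
    have "s' ` C \<subseteq> s ` A" using sA sC a by force
    moreover have "s ` A \<subset> s ` C" using AC top by (force simp: A_def)
    ultimately have "s' ` C \<subset> s ` C" by blast
    then have card: "card (s' ` C) < card (s ` C)" using finite_C by (intro psubset_card_mono) auto
    have Mx: "Max (s ` incident E x) = Max (s' ` incident E x)
        + (if incident E x \<subseteq> A then 0 else M - M')" if x: "x \<in> V" "incident E x \<subseteq> C" for x
    proof (cases "incident E x \<subseteq> A")
      case True
      then have "s ` incident E x = s' ` incident E x" using sA by force
      with True show ?thesis by simp
    next
      case False
      then obtain g where g: "g \<in> incident E x" "g \<notin> A" by auto
      have "Max (s ` incident E x) = M"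
        using g x sC(1)[of g] le_M by (intro Max_eqI) force+
      moreover have "Max (s' ` incident E x) = M'"
        using g x sC(2)[of g] by (intro Max_eqI) (force simp: s'_def)+
      ultimately show ?thesis using False by simp
    qed
    have "(\<Sum>x | x \<in> V \<and> incident E x \<subseteq> C. (2 - real (deg E x)) * Max (s ` incident E x))
        = (\<Sum>x | x \<in> V \<and> incident E x \<subseteq> C. (2 - real (deg E x)) * Max (s' ` incident E x)
            + ((M - M') * (2 - real (deg E x))
              - (M - M') * (if incident E x \<subseteq> A then 2 - real (deg E x) else 0)))"
      by (intro sum.cong refl) (auto simp: Mx algebra_simps)
    also have "\<dots> = (\<Sum>x | x \<in> V \<and> incident E x \<subseteq> C. (2 - real (deg E x)) * Max (s' ` incident E x))
        + (M - M') * (\<beta> V E C - (\<Sum>x | x \<in> V \<and> incident E x \<subseteq> C.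
            if incident E x \<subseteq> A then 2 - real (deg E x) else 0))"
      by (simp only: sum.distrib sum_subtractf right_diff_distrib \<beta>_def sum_distrib_left)
    also have "(\<Sum>x | x \<in> V \<and> incident E x \<subseteq> C. if incident E x \<subseteq> A then 2 - real (deg E x) else 0)
        = \<beta> V E A"
      unfolding \<beta>_def using finite_vertices AC
      by (subst sum.inter_filter[symmetric]) (auto intro!: sum.cong)
    finally have vertex: "(\<Sum>x | x \<in> V \<and> incident E x \<subseteq> C. (2 - real (deg E x)) * Max (s ` incident E x))
      = (\<Sum>x | x \<in> V \<and> incident E x \<subseteq> C. (2 - real (deg E x)) * Max (s' ` incident E x))
        + (M - M') * (\<beta> V E C - \<beta> V E A)" .
    have "(\<Sum>e\<in>C. s e) = (\<Sum>e\<in>C. s' e + (M - M') * (if e \<in> C - A then 1 else 0))"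
      using sA sC by (intro sum.cong refl) (auto simp: A_def)
    also have "\<dots> = (\<Sum>e\<in>C. s' e) + (M - M') * card (C - A)"
      using finite_C by (simp add: sum.distrib set_diff_eq flip: sum_distrib_left sum.inter_filter)
    also have "real (card (C - A)) = real (card C) - real (card A)"
      using AC finA finite_C by (simp add: card_Diff_subset card_mono of_nat_diff)
    finally have edge: "(\<Sum>e\<in>C. s e) = (\<Sum>e\<in>C. s' e) + (M - M') * (real (card C) - real (card A))" .
    have "max_energy s = max_energy s' - (M - M') * (\<beta> V E A - c * card A)"
      unfolding max_energy_def vertex edge tight by (simp add: algebra_simps)
    moreover have "(M - M') * \<delta> \<le> (M - M') * (\<beta> V E A - c * card A)"
      using gap[OF False AC] M'M by (intro mult_left_mono) auto
    ultimately have step: "max_energy s \<le> max_energy s' - \<delta> * (M - M')" by (simp add: mult.commute)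
    have aC: "a \<in> C" using a AC by auto
    have le: "\<delta> * (s e - s f) \<le> \<delta> * (M - s f)"
      using le_M[OF less.prems(1)] assms(2) by (intro mult_left_mono) auto
    show ?thesis
    proof (cases "f \<in> A")
      case True
      have "max_energy s' \<le> - \<delta> * (M' - s f)"
        using less.hyps[OF card aC less.prems(2)] sA[OF a(1)] sA[OF True] a by simp
      with step le show ?thesis by (simp add: algebra_simps)
    next
      case False
      \<comment> \<open>Here \<open>f\<close> is at the top level, so \<open>s e - s f\<close> is
        nonpositive and the bound 0 is enough.\<close>
      have "max_energy s' \<le> 0" using less.hyps[OF card aC aC] by simp
      moreover have "0 \<le> \<delta> * (M - M')" using assms(2) M'M by simp
      ultimately show ?thesis using step le sC(1)[OF less.prems(2) False] by simp
    qed
  qed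
qed

lemma continuous_log_energy: "continuous_on S log_energy"
proof -
  have "(\<Sum>f\<in>incident E x. exp (s f)) \<noteq> 0" if "x \<in> V" for x and s :: "'a set \<Rightarrow> real"
    using sum_pos[of "incident E x" "\<lambda>f. exp (s f)"] incident_nonempty[OF E_nonempty that] by force
  then have "continuous_on UNIV log_energy"
    unfolding log_energy_eq[abs_def]
    by (intro continuous_intros continuous_on_product_coordinates) auto
  then show ?thesis by (rule continuous_on_subset) simp
qed

text \<open>Shifts allow the minimum on \<open>C\<close> to be 0; outside a large box the energy is
  then below its value at 0, and the box is compact.\<close>

lemma log_energy_attains_max:
  assumes strict: "\<And>A. A \<noteq> {} \<Longrightarrow> A \<subset> C \<Longrightarrow> c * card A < \<beta> V E A"
  obtains s where "\<And>s'. log_energy s' \<le> log_energy s"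
proof -
  \<comment> \<open>The element 1 keeps \<open>D\<close> nonempty when \<open>C\<close> has no
    proper nonempty subset.\<close>
  define D where "D = insert 1 ((\<lambda>A. \<beta> V E A - c * card A) ` {A. A \<noteq> {} \<and> A \<subset> C})"
  define \<delta> where "\<delta> = Min D"
  have "finite D" unfolding D_def using finite_C by (auto intro: finite_subset[of _ "Pow C"])
  then have \<delta>_le: "\<And>d. d \<in> D \<Longrightarrow> \<delta> \<le> d" unfolding \<delta>_def by simp
  have "\<delta> \<in> D" unfolding \<delta>_def by (rule Min_in[OF \<open>finite D\<close>]) (simp add: D_def)
  then consider "\<delta> = 1" | A where "A \<noteq> {}" "A \<subset> C" "\<delta> = \<beta> V E A - c * card A"
    unfolding D_def by blast
  then have \<delta>: "0 < \<delta>" by cases (use strict in auto)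
  have gap: "\<delta> \<le> \<beta> V E A - c * card A" if "A \<noteq> {}" "A \<subset> C" for A
    using that by (intro \<delta>_le) (auto simp: D_def)
  have bound: "log_energy s \<le> - \<delta> * (s e - s f)" if "e \<in> C" "f \<in> C" for s e f
    using log_energy_le_max_energy[of s] max_energy_le[OF gap \<delta> that, of s] by simp
  \<comment> \<open>A spread larger than \<open>R\<close> forces the energy below its value at the
    zero vector.\<close>
  define R where "R = - log_energy (\<lambda>_. 0) / \<delta>"
  obtain e0 where e0: "e0 \<in> C" using C by auto
  have R: "0 \<le> R" "- \<delta> * R = log_energy (\<lambda>_. 0)"
    using bound[OF e0 e0, of "\<lambda>_. 0"] \<delta> by (auto simp: R_def divide_nonpos_pos)
  define K where "K = {s. \<forall>e. s e \<in> (if e \<in> C then {0..R} else {0})}"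
  have "compact K" unfolding K_def by (rule compact_Pi_UNIV) auto
  moreover have zero: "(\<lambda>_. 0) \<in> K" using R by (auto simp: K_def)
  ultimately obtain s where s: "\<And>s'. s' \<in> K \<Longrightarrow> log_energy s' \<le> log_energy s"
    using continuous_attains_sup[OF _ _ continuous_log_energy, of K] by blast
  show thesis
  proof
    fix s' :: "'a set \<Rightarrow> real"
    define m where "m = Min (s' ` C)"
    have m_le: "m \<le> s' e" if "e \<in> C" for e using that finite_C by (simp add: m_def)
    have "m \<in> s' ` C" unfolding m_def using finite_C C(2) by (intro Min_in) auto
    then obtain f where f: "f \<in> C" "s' f = m" by auto
    \<comment> \<open>Coordinates outside \<open>C\<close> do not affect the energy and are set to 0
      so that \<open>r\<close> can lie in \<open>K\<close>.\<close>
    define r where "r e = (if e \<in> C then s' e + - m else 0)" for e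
    have "log_energy r = log_energy (\<lambda>e. s' e + - m)" by (rule log_energy_cong) (simp add: r_def)
    then have eq: "log_energy s' = log_energy r" by (simp only: log_energy_shift)
    show "log_energy s' \<le> log_energy s"
    proof (cases "\<forall>e\<in>C. r e \<le> R")
      case True
      then have "r \<in> K" using m_le by (auto simp: r_def K_def)
      from s[OF this] eq show ?thesis by simp
    next
      case False
      then obtain e where e: "e \<in> C" "R < r e" by force
      have "log_energy r \<le> - \<delta> * (r e - r f)" by (rule bound[OF e(1) f(1)])
      also have "\<dots> \<le> - \<delta> * R" using e f \<delta> by (simp add: r_def)
      also have "\<dots> \<le> log_energy s" using R s[OF zero] by simp
      finally show ?thesis using eq by simp
    qed
  qed
qed

text \<open>At a maximum the partial derivative in the direction of each edge \<open>e\<close>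
  vanishes, and it equals the curvature of \<open>e\<close> minus \<open>c\<close>.\<close>

lemma constant_curvature_exists:
  assumes strict: "\<And>A. A \<noteq> {} \<Longrightarrow> A \<subset> C \<Longrightarrow> c * card A < \<beta> V E A"
  obtains p where "\<And>e. 0 < p e" "\<And>e. e \<in> C \<Longrightarrow> restricted_curvature E C p e = c"
proof -
  obtain s where s: "\<And>s'. log_energy s' \<le> log_energy s"
    using log_energy_attains_max strict by blast
  define p where "p e = exp (- s e)" for e
  show thesis
  proof
    fix e assume e: "e \<in> C"
    define q where "q \<tau> f = exp (- (s f + (if f = e then \<tau> else 0)))" for \<tau> f
    define b where "b f = (if f = e then 1 else 0 :: real)" for f
    have "((\<lambda>\<tau>. q \<tau> f) has_real_derivative - q 0 f * b f) (at 0)" for f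
      unfolding q_def b_def by (cases "f = e") (auto intro!: derivative_eq_intros)
    then have "((\<lambda>\<tau>. energy V E C (\<lambda>_. c) (q \<tau>)) has_real_derivative
        (\<Sum>f\<in>C. (restricted_curvature E C (q 0) f - c) * b f)) (at 0)"
      by (intro energy_has_derivative C E_nonempty) (auto simp: q_def)
    moreover have "energy V E C (\<lambda>_. c) (q \<tau>) \<le> energy V E C (\<lambda>_. c) (q 0)" for \<tau>
    proof -
      have q_eq: "q \<tau> = (\<lambda>f. exp (- (s f + (if f = e then \<tau> else 0))))" for \<tau>
        by (simp add: q_def fun_eq_iff)
      show ?thesis
        using s[of "\<lambda>f. s f + (if f = e then \<tau> else 0)"] unfolding log_energy_def q_eq by simp
    qed
    ultimately have "(\<Sum>f\<in>C. (restricted_curvature E C (q 0) f - c) * b f) = 0"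
      using DERIV_local_max[of "\<lambda>\<tau>. energy V E C (\<lambda>_. c) (q \<tau>)" _ 0 1] by simp
    moreover have "q 0 = p" by (simp add: q_def p_def fun_eq_iff)
    ultimately show "restricted_curvature E C p e = c"
      using e finite_C by (simp add: b_def if_distrib[of "(*) _"] cong: if_cong)
  qed (simp add: p_def)
qed

end

section \<open>Components of the meeting graph\<close>

context
  fixes C :: "'a set set"
  assumes C: "C \<subseteq> E"
begin

definition meet_equiv :: "('a set \<times> 'a set) set" where
  "meet_equiv = {(e, f). e \<in> C \<and> f \<in> C \<and> (e, f) \<in> (meet_rel E C)\<^sup>*}"

lemma meet_components_eq: "meet_components E C = C // meet_equiv"
  by (simp add: meet_components_def meet_equiv_def)

lemma equiv_meet: "equiv C meet_equiv"
proof (rule equivI)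
  have "sym (meet_rel E C)" by (auto simp: sym_def meet_rel_def)
  then have "sym ((meet_rel E C)\<^sup>*)" by (rule sym_rtrancl)
  then show "sym meet_equiv" by (auto simp: meet_equiv_def sym_def)
qed (auto simp: meet_equiv_def refl_on_def trans_def)

lemma component_subset: "D \<in> meet_components E C \<Longrightarrow> D \<subseteq> C"
  using Union_quotient[OF equiv_meet] by (auto simp: meet_components_eq)

lemma component_nonempty: "D \<in> meet_components E C \<Longrightarrow> D \<noteq> {}"
  using in_quotient_imp_non_empty[OF equiv_meet] by (simp add: meet_components_eq)

lemma component_unique:
  assumes "D \<in> meet_components E C" "D' \<in> meet_components E C" "e \<in> D" "e \<in> D'"
  shows "D = D'"
  using quotient_disj[OF equiv_meet, of D D'] assms by (auto simp: meet_components_eq)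

lemma component_exists:
  assumes "e \<in> C"
  obtains D where "D \<in> meet_components E C" "e \<in> D"
  using Union_quotient[OF equiv_meet] assms by (auto simp: meet_components_eq)

lemma finite_components: "finite (meet_components E C)"
  using component_subset finite_subset[OF C finite_edges]
  by (intro finite_subset[of "meet_components E C" "Pow C"]) auto

lemma card_components: "card C = (\<Sum>D\<in>meet_components E C. card D)"
proof -
  have "pairwise disjnt (meet_components E C)"
    using component_unique by (fastforce simp: pairwise_def disjnt_def)
  moreover have "finite D" if "D \<in> meet_components E C" for D
    using component_subset[OF that] C finite_subset[OF _ finite_edges] by (meson order_trans)
  ultimately have "card (\<Union> (meet_components E C)) = (\<Sum>D\<in>meet_components E C. card D)"
    by (rule card_Union_disjoint)
  then show ?thesis by (simp add: meet_components_eq Union_quotient[OF equiv_meet])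
qed

text \<open>The edges of a star of degree at least 3 inside \<open>C\<close> are pairwise adjacent.
  Degree 2 creates no adjacency, but there \<open>2 - deg\<close> is 0.\<close>

lemma star_in_component:
  assumes "D \<in> meet_components E C" "e \<in> D" "e \<in> incident E x" "incident E x \<subseteq> C" "deg E x \<noteq> 2"
  shows "incident E x \<subseteq> D"
proof
  fix f assume f: "f \<in> incident E x"
  show "f \<in> D"
  proof (cases "e = f \<or> deg E x \<le> 1")
    case True
    with incident_pendant[of x e] assms f show ?thesis by auto
  next
    case False
    then have "(e, f) \<in> meet_rel E C" using assms f by (auto simp: meet_rel_def incident_def)
    then have "(e, f) \<in> meet_equiv" by (auto simp: meet_equiv_def meet_rel_def)
    then show ?thesis
      using assms(1,2) in_quotient_imp_closed[OF equiv_meet] by (simp add: meet_components_eq)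
  qed
qed

text \<open>Each star in \<open>C\<close> with nonzero coefficient lies in exactly one
  component.\<close>

lemma \<beta>_components:
  assumes "E \<noteq> {}"
  shows "\<beta> V E C = (\<Sum>D\<in>meet_components E C. \<beta> V E D)"
proof -
  have "(if incident E x \<subseteq> C then 2 - real (deg E x) else 0)
      = (\<Sum>D\<in>meet_components E C. if incident E x \<subseteq> D then 2 - real (deg E x) else 0)"
    if x: "x \<in> V" for x
  proof (cases "incident E x \<subseteq> C \<and> deg E x \<noteq> 2")
    case True
    obtain e where e: "e \<in> incident E x" using incident_nonempty[OF assms x] by auto
    then obtain D where D: "D \<in> meet_components E C" "e \<in> D" using True component_exists by blast
    have "incident E x \<subseteq> D' \<longleftrightarrow> D' = D" if "D' \<in> meet_components E C" for D'
      using star_in_component[OF D e] True component_unique[OF that D(1) _ D(2)] e by auto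
    then have "(\<Sum>D\<in>meet_components E C. if incident E x \<subseteq> D then 2 - real (deg E x) else 0)
        = (\<Sum>D'\<in>meet_components E C. if D' = D then 2 - real (deg E x) else 0)"
      by (intro sum.cong) auto
    with True D finite_components show ?thesis by simp
  next
    case False
    have "(\<Sum>D\<in>meet_components E C. if incident E x \<subseteq> D then 2 - real (deg E x) else 0) = 0"
      using False component_subset by (intro sum.neutral) auto
    with False show ?thesis by auto
  qed
  then show ?thesis unfolding \<beta>_if by (subst sum.swap) (intro sum.cong refl)
qed

lemma restricted_curvature_component:
  assumes "D \<in> meet_components E C" "e \<in> D"
  shows "restricted_curvature E C p e = restricted_curvature E D p e"
  unfolding restricted_curvature_def
proof (rule sum.mono_neutral_right)
  have e: "e \<in> E" using assms component_subset C by blast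
  show "finite {x. x \<in> e \<and> incident E x \<subseteq> C}"
    by (rule finite_subset[OF _ finite_vertices]) (use edge_in_V[OF e] in auto)
  show "{x. x \<in> e \<and> incident E x \<subseteq> D} \<subseteq> {x. x \<in> e \<and> incident E x \<subseteq> C}"
    using component_subset[OF assms(1)] by auto
  show "\<forall>x\<in>{x. x \<in> e \<and> incident E x \<subseteq> C} - {x. x \<in> e \<and> incident E x \<subseteq> D}.
      (2 - real (deg E x)) / (p e * (\<Sum>f\<in>incident E x. inverse (p f))) = 0"
    using star_in_component[OF assms] e by (fastforce simp: incident_def)
qed

text \<open>The curvature is summed over \<open>A\<close> and estimated vertex by vertex. Some star
  of degree at least 3 in \<open>C\<close> meets both \<open>A\<close> and its complement, and its
  shares are positive, so the inequality is strict.\<close>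

lemma \<beta>_gt_if_constant_curvature:
  assumes "E \<noteq> {}" and pos: "\<And>e. e \<in> C \<Longrightarrow> 0 < p e"
    and const: "\<And>e. e \<in> C \<Longrightarrow> restricted_curvature E C p e = c"
    and D: "D \<in> meet_components E C" and A: "A \<noteq> {}" "A \<subset> D"
  shows "c * card A < \<beta> V E A"
proof -
  have AC: "A \<subseteq> C" using A component_subset[OF D] by auto
  obtain a b where ab: "a \<in> A" "b \<in> D" "b \<notin> A" using A by auto
  then have "(a, b) \<in> meet_equiv"
    using quotient_eq_iff[OF equiv_meet, of D D a b] D A by (auto simp: meet_components_eq)
  then have "(a, b) \<in> (meet_rel E C)\<^sup>*" by (simp add: meet_equiv_def)
  \<comment> \<open>A chain of adjacent edges from \<open>a\<close> to \<open>b\<close> has a step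
    that leaves \<open>A\<close>; its meeting vertex is the \<open>y\<close> below.\<close>
  then have "b \<notin> A \<longrightarrow> (\<exists>e f. e \<in> A \<and> f \<notin> A \<and> (e, f) \<in> meet_rel E C)"
    using ab(1) by (induction rule: rtrancl_induct) blast+
  with ab obtain e f where "e \<in> A" "f \<notin> A" "(e, f) \<in> meet_rel E C" by blast
  then obtain y where y: "e \<in> A" "f \<notin> A" "e \<in> incident E y" "f \<in> incident E y" "3 \<le> deg E y"
    "incident E y \<subseteq> C" "y \<in> V"
    using AC C edge_in_V by (fastforce simp: meet_rel_def incident_def)
  let ?t = "\<lambda>x. \<Sum>e\<in>incident E x \<inter> A. (2 - real (deg E x)) * share E p x e"
  let ?u = "\<lambda>x. if incident E x \<subseteq> A then 2 - real (deg E x) else 0"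
  have sh: "(\<Sum>e\<in>incident E x. share E p x e) = 1" "\<And>e. e \<in> incident E x \<Longrightarrow> 0 < share E p x e"
    if "x \<in> V" "incident E x \<subseteq> C" for x
    using sum_share[of x p] share_pos[of x p] that pos incident_nonempty[OF assms(1) that(1)] by auto
  have le: "?t x \<le> ?u x" if x: "x \<in> V" "incident E x \<subseteq> C" for x
  proof (cases "incident E x \<subseteq> A")
    case True
    with sh(1)[OF x] show ?thesis by (simp add: Int_absorb2 flip: sum_distrib_left)
  next
    case False
    show ?thesis
    proof (cases "2 \<le> deg E x")
      case True
      have "(2 - real (deg E x)) * share E p x e \<le> 0" if "e \<in> incident E x \<inter> A" for e
        using True sh(2)[OF x, of e] that by (intro mult_nonpos_nonneg) auto
      then have "?t x \<le> 0" by (rule sum_nonpos)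
      with False show ?thesis by simp
    next
      case deg: False
      have "incident E x \<inter> A = {}" using incident_pendant[of x] deg False by fastforce
      with False show ?thesis by simp
    qed
  qed
  have lt: "?t y < ?u y"
  proof -
    have "0 < (\<Sum>e\<in>incident E y \<inter> A. share E p y e)"
      using y sh(2)[OF y(7,6)] by (intro sum_pos) auto
    then have "?t y < 0" using y by (simp add: mult_neg_pos flip: sum_distrib_left)
    with y show ?thesis by auto
  qed
  have "c * card A = (\<Sum>e\<in>A. restricted_curvature E C p e)"
    using const AC by (simp add: subset_iff)
  also have "\<dots> = (\<Sum>x | x \<in> V \<and> incident E x \<subseteq> C. ?t x)"
    unfolding restricted_curvature_eq_share by (rule sum_over_ends) (use AC C in auto)
  also have "\<dots> < (\<Sum>x | x \<in> V \<and> incident E x \<subseteq> C. ?u x)"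
  proof (rule sum_strict_mono_ex1)
    show "\<exists>x\<in>{x. x \<in> V \<and> incident E x \<subseteq> C}. ?t x < ?u x"
      by (rule bexI[of _ y]) (use lt y in auto)
  qed (use finite_vertices le in auto)
  also have "\<dots> = \<beta> V E A"
    unfolding \<beta>_def using finite_vertices AC
    by (subst sum.inter_filter[symmetric]) (auto intro!: sum.cong)
  finally show ?thesis .
qed

text \<open>Metrics on the components are glued; the curvature of an edge only involves weights from
  its own component.\<close>

lemma const_curvature_metrics_nonempty:
  fixes c :: real
  assumes "C \<noteq> {}"
    and tight: "\<And>D. D \<in> meet_components E C \<Longrightarrow> \<beta> V E D = c * card D"
    and strict: "\<And>D A. D \<in> meet_components E C \<Longrightarrow> A \<noteq> {} \<Longrightarrow> A \<subset> D \<Longrightarrow> c * card A < \<beta> V E A"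
  shows "const_curvature_metrics E C c \<noteq> {}"
proof -
  have "\<exists>p. (\<forall>e. 0 < p e) \<and> (\<forall>e\<in>D. restricted_curvature E D p e = c)"
    if D: "D \<in> meet_components E C" for D
  proof -
    have "D \<subseteq> E" using component_subset[OF D] C by auto
    then obtain p where "\<And>e. 0 < p e" "\<And>e. e \<in> D \<Longrightarrow> restricted_curvature E D p e = c"
      using constant_curvature_exists[OF _ component_nonempty[OF D] tight[OF D] strict[OF D]] by blast
    then show ?thesis by blast
  qed
  then obtain P where P: "\<And>D e. D \<in> meet_components E C \<Longrightarrow> 0 < P D e"
    "\<And>D e. D \<in> meet_components E C \<Longrightarrow> e \<in> D \<Longrightarrow> restricted_curvature E D (P D) e = c"
    by metis
  define comp where "comp e = meet_equiv `` {e}" for e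
  have comp: "comp e \<in> meet_components E C" if "e \<in> C" for e
    unfolding comp_def meet_components_eq by (rule quotientI[OF that])
  have comp_eq: "comp e = D" if "D \<in> meet_components E C" "e \<in> D" for D e
  proof (rule component_unique[of _ _ e])
    have e: "e \<in> C" using that component_subset by blast
    then show "comp e \<in> meet_components E C" by (rule comp)
    show "e \<in> comp e" unfolding comp_def by (rule equiv_class_self[OF equiv_meet e])
  qed (use that in auto)
  define Z where "Z = (\<Sum>e\<in>C. P (comp e) e)"
  have finC: "finite C" using C by (rule finite_subset) simp
  have Z: "0 < Z" unfolding Z_def using finC assms(1) comp P by (intro sum_pos) auto
  \<comment> \<open>Division by \<open>Z\<close> gives total mass 1, and \<open>restrict\<close>
    makes the metric undefined outside \<open>C\<close>, as \<open>open_simplex\<close>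
    requires.\<close>
  define p where "p = restrict (\<lambda>e. inverse Z * P (comp e) e) C"
  have "p \<in> open_simplex C"
    using Z comp P(1) by (auto simp: open_simplex_def p_def simp flip: sum_distrib_left Z_def)
  moreover have "restricted_curvature E C p e = c" if "e \<in> C" for e
  proof -
    obtain D where D: "D \<in> meet_components E C" "e \<in> D" using component_exists \<open>e \<in> C\<close> by blast
    have "restricted_curvature E C p e = restricted_curvature E D p e"
      by (rule restricted_curvature_component[OF D])
    also have "\<dots> = restricted_curvature E D (P D) e"
      using Z D component_subset[OF D(1)] comp_eq[OF D(1)]
      by (intro restricted_curvature_scale[of "inverse Z"]) (auto simp: p_def)
    finally show ?thesis using P(2)[OF D] by simp
  qed
  ultimately show ?thesis by (auto simp: const_curvature_metrics_def)
qed

end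

end

section \<open>Application to the edges of minimal limiting curvature\<close>

theorem corollary1p7:
  fixes V :: "'a set" and E :: "'a set set" and w :: "real \<Rightarrow> 'a set \<Rightarrow> real"
  assumes "finite_tree V E"
    and "E \<noteq> {}"
    and "normalized_flow V E w"
  shows "(\<forall>C \<in> meet_components E (min_edges V E w).
            \<beta> V E C = min_curvature V E w * real (card C)) \<and>
         (const_curvature_metrics E (min_edges V E w) (min_curvature V E w) \<noteq> {} \<longleftrightarrow>
            (\<forall>C \<in> meet_components E (min_edges V E w).
               \<forall>A. A \<noteq> {} \<and> A \<subset> C \<longrightarrow> \<beta> V E A > min_curvature V E w * real (card A)))"
proof -
  interpret finite_tree V E by fact
  obtain q where q: "min_norm q" using min_norm_exists[OF assms(2)] .
  then have qD: "q \<in> edge_distributions V E" by (simp add: min_norm_def)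
  define c where "c = min_curvature V E w"
  define C where "C = min_edges V E w"
  have lim: "limit_curvature V E w e = excess E q e" if "e \<in> E" for e
    unfolding limit_curvature_def
    by (rule tendsto_Lim) (use curvature_tendsto[OF assms(3,2) q that] in auto)
  then have "limit_curvature V E w ` E = excess E q ` E" by (intro image_cong) auto
  then have c: "c = Min (excess E q ` E)" by (simp add: c_def min_curvature_def)
  have C: "C = {e \<in> E. excess E q e = c}"
    using lim by (auto simp: C_def min_edges_def c_def)
  then have CE: "C \<subseteq> E" by auto
  have "c \<in> excess E q ` E" unfolding c using assms(2) by (intro Min_in) auto
  then have ne: "C \<noteq> {}" by (auto simp: C)
  have "\<beta> V E C = (\<Sum>e\<in>C. excess E q e)"
    using min_norm_tight[OF assms(2) q] by (simp add: C c)
  also have "\<dots> = (\<Sum>e\<in>C. c)" by (intro sum.cong) (auto simp: C)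
  finally have tightC: "\<beta> V E C = c * card C" by simp
  have ge: "c * card A \<le> \<beta> V E A" if "A \<subseteq> E" for A
  proof -
    have "c * card A = (\<Sum>e\<in>A. c)" by simp
    also have "\<dots> \<le> (\<Sum>e\<in>A. excess E q e)" unfolding c using that by (intro sum_mono) auto
    also have "\<dots> \<le> \<beta> V E A" by (rule sum_excess_le_\<beta>[OF qD that])
    finally show ?thesis .
  qed
  have zero: "(\<Sum>D\<in>meet_components E C. \<beta> V E D - c * card D) = 0"
    unfolding sum_subtractf sum_distrib_left[symmetric] of_nat_sum[symmetric]
      card_components[OF CE, symmetric] \<beta>_components[OF CE assms(2), symmetric] tightC by simp
  \<comment> \<open>Every summand of \<open>zero\<close> is nonnegative by \<open>ge\<close>, so
    each vanishes.\<close>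
  have tight: "\<beta> V E D = c * card D" if "D \<in> meet_components E C" for D
  proof -
    have "0 \<le> \<beta> V E D - c * card D" if "D \<in> meet_components E C" for D
      using ge[of D] component_subset[OF CE that] CE by auto
    then have "\<beta> V E D - c * card D = 0"
      by (intro sum_nonneg_0[OF finite_components[OF CE] _ zero that])
    then show ?thesis by simp
  qed
  have "const_curvature_metrics E C c \<noteq> {} \<longleftrightarrow>
      (\<forall>D \<in> meet_components E C. \<forall>A. A \<noteq> {} \<and> A \<subset> D \<longrightarrow> c * card A < \<beta> V E A)" (is "?l \<longleftrightarrow> ?r")
  proof
    assume ?l
    then obtain p where "p \<in> const_curvature_metrics E C c" by auto
    then have "\<And>e. e \<in> C \<Longrightarrow> 0 < p e" "\<And>e. e \<in> C \<Longrightarrow> restricted_curvature E C p e = c"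
      by (auto simp: const_curvature_metrics_def open_simplex_def)
    then show ?r using \<beta>_gt_if_constant_curvature[OF CE assms(2)] by blast
  next
    assume ?r
    then show ?l using const_curvature_metrics_nonempty[OF CE ne tight] by blast
  qed
  with tight show ?thesis unfolding c_def C_def by blast
qed

end
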